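(* Let $T$ be a complete theory of pure probability logic. If $M,N$ are two complete models of $T$ with full support, then $M\cong N$. Moreover, any two tuples in $M$ with the same pure probability logic type are conjugate by an automorphism of $M$.
   Context: $L$ is a real-valued continuous logic language with a distinguished formula $d(x,y)$ interpreted as a metric, all relations uniformly continuous with respect to $d$; structures carry expectation quantifiers $E_x$ (operators from formulas $\phi(x,y)$ to formulas in $y$ satisfying $E_x1=1$, linearity, $E_x(\psi\phi)=\psi E_x\phi$ when $x$ is not free in $\psi$, $E_x|\phi|\ge0$ and $E_x\phi\le\sup_x\phi$). Pure probability logic formulas are the closure of quantifier-free formulas under continuous connectives and expectation quantifiers; a complete pure probability logic theory specifies the value of every such sentence. In a model $M$ the expectation quantifiers induce a regular Borel measure on each (pure probability logic) type space $S_x(M)$. $M$ has full support if every ball in $M$ has positive measure; $M$ is complete if it is complete as a metric space. *)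

theory Defs
  imports "HOL-Probability.Probability"
begin

text \<open>
  Variables are natural numbers. A connective of arity \<open>n\<close> is a function on lists of
  length \<open>n\<close>; its values on lists of other lengths are irrelevant.
  The datatype has no sup/inf quantifiers: its well-formed members are exactly the closure of
  the atomic formulas under continuous connectives and expectation quantifiers.
\<close>

datatype 'r fm =
    Rel 'r "nat list"
  | Conn "real list \<Rightarrow> real" "'r fm list"
  | Expect nat "'r fm"

text \<open>
  The metric is a formula in the variables \<open>0\<close> and \<open>1\<close>. As usual in continuous logic, each
  relation symbol comes with a bound on its values and a modulus of uniform continuity.
\<close>

record 'r language =
  arity :: "'r \<Rightarrow> nat"
  bound :: "'r \<Rightarrow> real"
  modulus :: "'r \<Rightarrow> real \<Rightarrow> real"
  metric :: "'r fm"

fun wf_fm :: "'r language \<Rightarrow> 'r fm \<Rightarrow> bool" where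
  "wf_fm L (Rel R xs) \<longleftrightarrow> length xs = arity L R"
| "wf_fm L (Conn u \<phi>s) \<longleftrightarrow>
     continuous_on UNIV (\<lambda>t :: nat \<Rightarrow> real. u (map t [0..<length \<phi>s])) \<and>
     (\<forall>\<phi>\<in>set \<phi>s. wf_fm L \<phi>)"
| "wf_fm L (Expect x \<phi>) \<longleftrightarrow> wf_fm L \<phi>"

fun fv :: "'r fm \<Rightarrow> nat set" where
  "fv (Rel R xs) = set xs"
| "fv (Conn u \<phi>s) = (\<Union>\<phi>\<in>set \<phi>s. fv \<phi>)"
| "fv (Expect x \<phi>) = fv \<phi> - {x}"

definition is_language :: "'r language \<Rightarrow> bool" where
  "is_language L \<longleftrightarrow>
     (\<forall>R. \<forall>\<epsilon>>0. modulus L R \<epsilon> > 0) \<and> wf_fm L (metric L) \<and> fv (metric L) \<subseteq> {0, 1}"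

definition One_fm :: "'r fm" where
  "One_fm = Conn (\<lambda>_. 1) []"

definition Plus_fm :: "'r fm \<Rightarrow> 'r fm \<Rightarrow> 'r fm" where
  "Plus_fm \<phi> \<psi> = Conn (\<lambda>t. t ! 0 + t ! 1) [\<phi>, \<psi>]"

definition Times_fm :: "'r fm \<Rightarrow> 'r fm \<Rightarrow> 'r fm" where
  "Times_fm \<phi> \<psi> = Conn (\<lambda>t. t ! 0 * t ! 1) [\<phi>, \<psi>]"

definition Scale_fm :: "real \<Rightarrow> 'r fm \<Rightarrow> 'r fm" where
  "Scale_fm c \<phi> = Conn (\<lambda>t. c * t ! 0) [\<phi>]"

definition Abs_fm :: "'r fm \<Rightarrow> 'r fm" where
  "Abs_fm \<phi> = Conn (\<lambda>t. \<bar>t ! 0\<bar>) [\<phi>]"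

text \<open>
  The expectation quantifiers of a structure are interpreted by one functional \<open>expn\<close> on
  real functions on the universe. Nothing is lost: by linearity and \<open>E\<^sub>x \<phi> \<le> sup\<^sub>x \<phi>\<close>, the
  value of \<open>E\<^sub>x \<phi>\<close> at parameters \<open>b\<close> depends only on the function \<open>\<phi>(x,b)\<close> of \<open>x\<close>.
  Only its values on functions definable with parameters matter.
\<close>

record ('r, 'a) struct =
  univ :: "'a set"
  rel :: "'r \<Rightarrow> 'a list \<Rightarrow> real"
  expn :: "('a \<Rightarrow> real) \<Rightarrow> real"

fun val :: "('r, 'a) struct \<Rightarrow> 'r fm \<Rightarrow> (nat \<Rightarrow> 'a) \<Rightarrow> real" where
  "val M (Rel R xs) v = rel M R (map v xs)"
| "val M (Conn u \<phi>s) v = u (map (\<lambda>\<phi>. val M \<phi> v) \<phi>s)"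
| "val M (Expect x \<phi>) v = expn M (\<lambda>c\<in>univ M. val M \<phi> (v(x := c)))"

definition assigns :: "('r, 'a) struct \<Rightarrow> (nat \<Rightarrow> 'a) set" where
  "assigns M = (UNIV \<rightarrow> univ M)"

text \<open>The value outside the universe is set to \<open>0\<close> because \<^locale>\<open>Metric_space\<close>
  demands nonnegativity and symmetry on the whole type.\<close>

definition mdist_of :: "'r language \<Rightarrow> ('r, 'a) struct \<Rightarrow> 'a \<Rightarrow> 'a \<Rightarrow> real" where
  "mdist_of L M a b =
     (if a \<in> univ M \<and> b \<in> univ M then val M (metric L) (\<lambda>i. if i = 0 then a else b) else 0)"

definition expectation_axioms :: "'r language \<Rightarrow> ('r, 'a) struct \<Rightarrow> bool" where
  "expectation_axioms L M \<longleftrightarrow>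
     (\<forall>x. \<forall>v\<in>assigns M.
        val M (Expect x One_fm) v = 1 \<and>
        (\<forall>\<phi>. wf_fm L \<phi> \<longrightarrow>
           (\<forall>c. val M (Expect x (Scale_fm c \<phi>)) v = c * val M (Expect x \<phi>) v) \<and>
           val M (Expect x (Abs_fm \<phi>)) v \<ge> 0 \<and>
           val M (Expect x \<phi>) v \<le> (SUP c\<in>univ M. val M \<phi> (v(x := c)))) \<and>
        (\<forall>\<phi> \<psi>. wf_fm L \<phi> \<longrightarrow> wf_fm L \<psi> \<longrightarrow>
           val M (Expect x (Plus_fm \<phi> \<psi>)) v = val M (Expect x \<phi>) v + val M (Expect x \<psi>) v \<and>
           (x \<notin> fv \<psi> \<longrightarrow>
              val M (Expect x (Times_fm \<psi> \<phi>)) v = val M \<psi> v * val M (Expect x \<phi>) v)))"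

definition is_structure :: "'r language \<Rightarrow> ('r, 'a) struct \<Rightarrow> bool" where
  "is_structure L M \<longleftrightarrow>
     univ M \<noteq> {} \<and>
     Metric_space (univ M) (mdist_of L M) \<and>
     (\<forall>R as. as \<in> lists (univ M) \<longrightarrow> length as = arity L R \<longrightarrow> \<bar>rel M R as\<bar> \<le> bound L R) \<and>
     (\<forall>R as bs. \<forall>\<epsilon>>0. as \<in> lists (univ M) \<longrightarrow> bs \<in> lists (univ M) \<longrightarrow>
        length as = arity L R \<longrightarrow> length bs = arity L R \<longrightarrow>
        (\<forall>i<arity L R. mdist_of L M (as ! i) (bs ! i) < modulus L R \<epsilon>) \<longrightarrow>
        \<bar>rel M R as - rel M R bs\<bar> \<le> \<epsilon>) \<and>
     expectation_axioms L M"

definition complete_structure :: "'r language \<Rightarrow> ('r, 'a) struct \<Rightarrow> bool" where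
  "complete_structure L M \<longleftrightarrow> Metric_space.mcomplete (univ M) (mdist_of L M)"

text \<open>A theory is a set of conditions \<open>\<sigma> = r\<close> with \<open>\<sigma>\<close> a sentence and \<open>r\<close> a real number.\<close>

definition complete_theory :: "'r language \<Rightarrow> ('r fm \<times> real) set \<Rightarrow> bool" where
  "complete_theory L T \<longleftrightarrow>
     (\<forall>(\<sigma>, r)\<in>T. wf_fm L \<sigma> \<and> fv \<sigma> = {}) \<and>
     (\<forall>\<sigma>. wf_fm L \<sigma> \<longrightarrow> fv \<sigma> = {} \<longrightarrow> (\<exists>!r. (\<sigma>, r) \<in> T))"

definition models :: "'r language \<Rightarrow> ('r, 'a) struct \<Rightarrow> ('r fm \<times> real) set \<Rightarrow> bool" where
  "models L M T \<longleftrightarrow> is_structure L M \<and> (\<forall>(\<sigma>, r)\<in>T. \<forall>v\<in>assigns M. val M \<sigma> v = r)"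

text \<open>
  A formula with parameters in \<open>M\<close> is a pair of a formula and an assignment. A type over \<open>M\<close>
  in the variable \<open>x\<close> gives a value to each such pair (the assignment's value at \<open>x\<close> is
  ignored) and is approximately finitely satisfiable in \<open>M\<close>. The logic topology is the
  subspace topology from the product topology on functions.
\<close>

definition fm_over :: "'r language \<Rightarrow> ('r, 'a) struct \<Rightarrow> ('r fm \<times> (nat \<Rightarrow> 'a)) set" where
  "fm_over L M = {\<phi>. wf_fm L \<phi>} \<times> assigns M"

definition types_over ::
    "'r language \<Rightarrow> ('r, 'a) struct \<Rightarrow> nat \<Rightarrow> ('r fm \<times> (nat \<Rightarrow> 'a) \<Rightarrow> real) set" where
  "types_over L M x =
     {p \<in> extensional (fm_over L M).
        \<forall>F \<subseteq> fm_over L M. finite F \<longrightarrow>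
          (\<forall>\<epsilon>>0. \<exists>c\<in>univ M. \<forall>(\<phi>, v)\<in>F. \<bar>val M \<phi> (v(x := c)) - p (\<phi>, v)\<bar> < \<epsilon>)}"

definition regular_borel_on :: "'b::topological_space set \<Rightarrow> 'b measure \<Rightarrow> bool" where
  "regular_borel_on S \<mu> \<longleftrightarrow>
     space \<mu> = S \<and> sets \<mu> = sets (restrict_space borel S) \<and>
     (\<forall>A\<in>sets \<mu>.
        emeasure \<mu> A = (INF U\<in>{U. openin (top_of_set S) U \<and> A \<subseteq> U}. emeasure \<mu> U) \<and>
        emeasure \<mu> A = (SUP K\<in>{K. compact K \<and> K \<subseteq> A}. emeasure \<mu> K))"

text \<open>\<open>\<mu>\<close> is the measure on the type space that represents \<open>E\<^sub>x\<close> (unique, by Riesz).\<close>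

definition induced_measure ::
    "'r language \<Rightarrow> ('r, 'a) struct \<Rightarrow> nat \<Rightarrow> ('r fm \<times> (nat \<Rightarrow> 'a) \<Rightarrow> real) measure \<Rightarrow> bool" where
  "induced_measure L M x \<mu> \<longleftrightarrow>
     regular_borel_on (types_over L M x) \<mu> \<and> prob_space \<mu> \<and>
     (\<forall>(\<phi>, v)\<in>fm_over L M. (\<integral>p. p (\<phi>, v) \<partial>\<mu>) = val M (Expect x \<phi>) v)"

text \<open>The ball around \<open>a\<close> is the open set of types given by \<open>d(x,a) < r\<close>, with variable
  \<open>0\<close> for \<open>x\<close>.\<close>

definition type_ball ::
    "'r language \<Rightarrow> ('r, 'a) struct \<Rightarrow> 'a \<Rightarrow> real \<Rightarrow> ('r fm \<times> (nat \<Rightarrow> 'a) \<Rightarrow> real) set" where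
  "type_ball L M a r = {p \<in> types_over L M 0. p (metric L, \<lambda>_. a) < r}"

definition full_support :: "'r language \<Rightarrow> ('r, 'a) struct \<Rightarrow> bool" where
  "full_support L M \<longleftrightarrow>
     (\<exists>\<mu>. induced_measure L M 0 \<mu> \<and>
        (\<forall>a\<in>univ M. \<forall>r>0. measure \<mu> (type_ball L M a r) > 0))"

text \<open>Isomorphisms respect the relations and the expectation quantifiers, hence the values of
  all formulas; in particular they are isometries.\<close>

definition is_iso ::
    "'r language \<Rightarrow> ('a \<Rightarrow> 'b) \<Rightarrow> ('r, 'a) struct \<Rightarrow> ('r, 'b) struct \<Rightarrow> bool" where
  "is_iso L f M N \<longleftrightarrow>
     bij_betw f (univ M) (univ N) \<and>
     (\<forall>R as. as \<in> lists (univ M) \<longrightarrow> length as = arity L R \<longrightarrow>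
        rel N R (map f as) = rel M R as) \<and>
     (\<forall>x \<phi>. \<forall>v\<in>assigns M. wf_fm L \<phi> \<longrightarrow>
        val N (Expect x \<phi>) (f \<circ> v) = val M (Expect x \<phi>) v)"

text \<open>The type of a tuple: the \<open>i\<close>-th entry is the value of variable \<open>i\<close>.\<close>

definition tp ::
    "'r language \<Rightarrow> ('r, 'a) struct \<Rightarrow> 'a list \<Rightarrow> ('r fm \<times> real) set" where
  "tp L M as =
     {(\<phi>, r). wf_fm L \<phi> \<and> fv \<phi> \<subseteq> {..<length as} \<and>
        (\<forall>v\<in>assigns M. (\<forall>i<length as. v i = as ! i) \<longrightarrow> val M \<phi> v = r)}"

end

theory Submission
  imports Defs
begin

text \<open>
  The isomorphism comes from a back-and-forth between dense sequences. The measure need not be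
  concentrated on realized types, so a type realized by \<open>c\<close> in \<open>M\<close> has to be realized in \<open>N\<close>
  without appeal to genericity. Since the ball around \<open>c\<close> has positive measure, any finite part
  of its type has positive expectation, hence is approximately satisfied in \<open>N\<close>. The measures of
  balls around a point are definable and full support makes them positive at \<open>c\<close>; as disjoint
  balls have total measure at most \<open>1\<close>, the points of \<open>N\<close> whose balls have measures bounded below
  form a totally bounded set. So better and better approximate realizations in \<open>N\<close> have a
  convergent subsequence, and its limit realizes the type.
\<close>

section \<open>Renaming variables\<close>

text \<open>Formulas have no suprema or infima, so an existence statement cannot be carried from
  \<open>M\<close> to \<open>N\<close> as such. What can be carried over is the value of an
  expectation, and the axiom bounding an expectation by the supremum turns a positive value into a
  witness. The measure on types of one model cannot be compared with that of the other directly; the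
  expectation of a bump around a point can, because it is the value of a formula whose free variable
  is the centre. It is thus part of the type of \<open>c\<close> and is inherited, up to a small
  error, by approximate realizations in \<open>N\<close>. The measures enter through two facts only:
  these expectations are positive, and well separated centres obey a packing inequality. Since an
  isomorphism has to respect expectations and not just distances, the dense sequences are matched
  for all formulas at once, and passing to limits rests on the uniform continuity of every
  formula.\<close>

primrec ren :: "(nat \<Rightarrow> nat) \<Rightarrow> 'r fm \<Rightarrow> 'r fm" where
  "ren \<sigma> (Rel R xs) = Rel R (map \<sigma> xs)"
| "ren \<sigma> (Conn u \<phi>s) = Conn u (map (ren \<sigma>) \<phi>s)"
| "ren \<sigma> (Expect x \<phi>) = Expect (\<sigma> x) (ren \<sigma> \<phi>)"

lemma wf_ren [simp]: "wf_fm L (ren \<sigma> \<phi>) \<longleftrightarrow> wf_fm L \<phi>"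
  by (induction \<phi>) auto

lemma fv_ren: "inj \<sigma> \<Longrightarrow> fv (ren \<sigma> \<phi>) = \<sigma> ` fv \<phi>"
  by (induction \<phi>) (auto simp: inj_image_mem_iff dest: injD)

lemma finite_fv: "finite (fv \<phi>)"
  by (induction \<phi>) auto

lemma val_cong: "(\<And>i. i \<in> fv \<phi> \<Longrightarrow> v i = w i) \<Longrightarrow> val M \<phi> v = val M \<phi> w"
proof (induction \<phi> arbitrary: v w)
  case (Rel R xs)
  then have "map v xs = map w xs" by simp
  then show ?case by (simp only: val.simps)
next
  case (Conn u \<phi>s)
  have "map (\<lambda>\<phi>. val M \<phi> v) \<phi>s = map (\<lambda>\<phi>. val M \<phi> w) \<phi>s"
  proof (rule map_cong)
    fix \<phi> assume "\<phi> \<in> set \<phi>s"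
    then show "val M \<phi> v = val M \<phi> w"
      by (rule Conn.IH) (use Conn.prems \<open>\<phi> \<in> set \<phi>s\<close> in auto)
  qed simp
  then show ?case by (simp only: val.simps)
next
  case (Expect x \<phi>)
  have "val M \<phi> (v(x := c)) = val M \<phi> (w(x := c))" for c
    by (rule Expect.IH) (use Expect.prems in auto)
  then show ?case by (simp only: val.simps)
qed

text \<open>Bound variables are renamed together with free ones. Injectivity excludes capture:
  updating \<open>v\<close> at \<open>\<sigma> x\<close> changes \<open>v \<circ> \<sigma>\<close>
  at \<open>x\<close> alone.\<close>

lemma val_ren: "inj \<sigma> \<Longrightarrow> val M (ren \<sigma> \<phi>) v = val M \<phi> (v \<circ> \<sigma>)"
proof (induction \<phi> arbitrary: v)
  case (Rel R xs)
  then show ?case by (simp add: comp_def)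
next
  case (Conn u \<phi>s)
  have "map (\<lambda>\<phi>. val M \<phi> v) (map (ren \<sigma>) \<phi>s) = map (\<lambda>\<phi>. val M \<phi> (v \<circ> \<sigma>)) \<phi>s"
    using Conn by (auto simp: comp_def)
  then show ?case by (simp only: ren.simps val.simps)
next
  case (Expect x \<phi>)
  have "v(\<sigma> x := c) \<circ> \<sigma> = (v \<circ> \<sigma>)(x := c)" for c
    using \<open>inj \<sigma>\<close> by (auto simp: fun_eq_iff inj_eq)
  then show ?case using Expect by (simp only: ren.simps val.simps)
qed

lemma wf_Scale [simp]: "wf_fm L (Scale_fm c \<phi>) \<longleftrightarrow> wf_fm L \<phi>"
  by (auto simp: Scale_fm_def intro!: continuous_intros)

lemma wf_Plus [simp]: "wf_fm L (Plus_fm \<phi> \<psi>) \<longleftrightarrow> wf_fm L \<phi> \<and> wf_fm L \<psi>"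
  by (auto simp: Plus_fm_def intro!: continuous_intros)

lemma val_Scale [simp]: "val M (Scale_fm c \<phi>) v = c * val M \<phi> v"
  by (simp add: Scale_fm_def)

lemma val_Plus [simp]: "val M (Plus_fm \<phi> \<psi>) v = val M \<phi> v + val M \<psi> v"
  by (simp add: Plus_fm_def)

section \<open>Continuous connectives\<close>

text \<open>Continuity of a connective is formulated on the infinite product
  \<open>nat \<Rightarrow> real\<close>, so Tychonoff's theorem supplies the compact set on which it
  is bounded and uniformly continuous.\<close>

lemma compact_cube: "compact {t :: nat \<Rightarrow> real. \<forall>i. \<bar>t i\<bar> \<le> B}"
proof -
  have "compactin (product_topology (\<lambda>_. euclidean) UNIV) (PiE UNIV (\<lambda>_ :: nat. {-B..B :: real}))"
    by (subst compactin_PiE) auto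
  then have "compact (PiE UNIV (\<lambda>_ :: nat. {-B..B}))"
    unfolding euclidean_product_topology compactin_euclidean_iff .
  moreover have "PiE UNIV (\<lambda>_. {-B..B}) = {t :: nat \<Rightarrow> real. \<forall>i. \<bar>t i\<bar> \<le> B}"
    by (simp add: PiE_UNIV_domain Pi_def abs_le_iff minus_le_iff[of _ B] conj_commute)
  ultimately show ?thesis
    by simp
qed

text \<open>The metric on functions is a sum of truncated coordinate distances with weights (1/2)^n;
  the total weight 2 is the factor here.\<close>

lemma dist_fun_le:
  fixes s t :: "nat \<Rightarrow> real"
  assumes "\<And>i. \<bar>s i - t i\<bar> \<le> \<delta>"
  shows "dist s t \<le> 2 * \<delta>"
proof (rule field_le_epsilon)
  fix e :: real assume "e > 0"
  then obtain n where n: "(1/2)^n < e"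
    using real_arch_pow_inv[of e "1/2"] by auto
  have "Max {dist (s (from_nat i)) (t (from_nat i)) | i. i \<le> n} \<le> \<delta>"
    by (rule Max.boundedI) (use assms in \<open>auto simp: dist_real_def\<close>)
  then show "dist s t \<le> 2 * \<delta> + e"
    using dist_fun_le_dist_first_terms[of s t n] n by linarith
qed

text \<open>Turns an argument list of a connective into a point of the product space; the default 0
  keeps it inside a cube centred at the origin.\<close>

definition pad :: "real list \<Rightarrow> nat \<Rightarrow> real" where
  "pad xs i = (if i < length xs then xs ! i else 0)"

lemma map_pad: "map (pad xs) [0..<length xs] = xs"
  by (rule nth_equalityI) (auto simp: pad_def)

lemma abs_pad_le: "(\<And>i. i < length xs \<Longrightarrow> \<bar>xs ! i\<bar> \<le> B) \<Longrightarrow> \<bar>pad xs i\<bar> \<le> max 0 B"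
  by (simp add: pad_def le_max_iff_disj)

lemma connective_bounded:
  assumes "continuous_on UNIV (\<lambda>t :: nat \<Rightarrow> real. u (map t [0..<n]) :: real)"
  shows "\<exists>C. \<forall>xs. length xs = n \<longrightarrow> (\<forall>i<n. \<bar>xs ! i\<bar> \<le> B) \<longrightarrow> \<bar>u xs\<bar> \<le> C"
proof -
  \<comment> \<open>Callers take for \<open>B\<close> a maximum over the arguments, which is
    unspecified when there are none. With \<open>max 0 B\<close> the zero padding lies in the cube
    in any case.\<close>
  let ?K = "{t :: nat \<Rightarrow> real. \<forall>i. \<bar>t i\<bar> \<le> max 0 B}"
  have "compact ((\<lambda>t. u (map t [0..<n])) ` ?K)"
    by (intro compact_continuous_image compact_cube continuous_on_subset[OF assms]) auto
  then obtain C where C: "\<And>t. t \<in> ?K \<Longrightarrow> \<bar>u (map t [0..<n])\<bar> \<le> C"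
    by (metis (no_types, lifting) bounded_iff compact_imp_bounded image_eqI real_norm_def)
  show ?thesis
  proof (intro exI[of _ C] allI impI)
    fix xs :: "real list" assume xs: "length xs = n" "\<forall>i<n. \<bar>xs ! i\<bar> \<le> B"
    have "pad xs \<in> ?K" using xs by (simp add: abs_pad_le)
    then show "\<bar>u xs\<bar> \<le> C" using C[of "pad xs"] map_pad[of xs] xs by simp
  qed
qed

lemma connective_uniformly_continuous:
  assumes "continuous_on UNIV (\<lambda>t :: nat \<Rightarrow> real. u (map t [0..<n]) :: real)" "\<epsilon> > 0"
  shows "\<exists>\<delta>>0. \<forall>xs ys. length xs = n \<longrightarrow> length ys = n \<longrightarrow>
    (\<forall>i<n. \<bar>xs ! i\<bar> \<le> B \<and> \<bar>ys ! i\<bar> \<le> B \<and> \<bar>xs ! i - ys ! i\<bar> \<le> \<delta>) \<longrightarrow> \<bar>u xs - u ys\<bar> \<le> \<epsilon>"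
proof -
  let ?K = "{t :: nat \<Rightarrow> real. \<forall>i. \<bar>t i\<bar> \<le> max 0 B}"
  have "uniformly_continuous_on ?K (\<lambda>t. u (map t [0..<n]))"
    by (intro compact_uniformly_continuous compact_cube continuous_on_subset[OF assms(1)]) auto
  then obtain \<delta> where \<delta>: "\<delta> > 0" "\<And>s t. s \<in> ?K \<Longrightarrow> t \<in> ?K \<Longrightarrow> dist t s < \<delta> \<Longrightarrow>
      dist (u (map t [0..<n])) (u (map s [0..<n])) < \<epsilon>"
    using \<open>\<epsilon> > 0\<close> unfolding uniformly_continuous_on_def by meson
  show ?thesis
  \<comment> \<open>The factor 2 of \<open>dist_fun_le\<close> turns \<delta>/3 into 2\<delta>/3,
    strictly below \<delta>.\<close>
  proof (intro exI[of _ "\<delta> / 3"] conjI allI impI)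
    show "\<delta> / 3 > 0" using \<delta> by simp
    fix xs ys :: "real list"
    assume xs: "length xs = n" "length ys = n"
      "\<forall>i<n. \<bar>xs ! i\<bar> \<le> B \<and> \<bar>ys ! i\<bar> \<le> B \<and> \<bar>xs ! i - ys ! i\<bar> \<le> \<delta> / 3"
    have K: "pad xs \<in> ?K" "pad ys \<in> ?K"
      using xs by (simp_all add: abs_pad_le)
    have "dist (pad xs) (pad ys) \<le> 2 * (\<delta> / 3)"
      by (rule dist_fun_le) (use xs \<open>\<delta> > 0\<close> in \<open>auto simp: pad_def\<close>)
    then have "dist (pad xs) (pad ys) < \<delta>" using \<open>\<delta> > 0\<close> by linarith
    from \<delta>(2)[OF K(2,1) this] show "\<bar>u xs - u ys\<bar> \<le> \<epsilon>"
      using map_pad[of xs] map_pad[of ys] xs by (simp add: dist_real_def)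
  qed
qed

section \<open>Formulas are bounded and uniformly continuous\<close>

lemma assigns_upd [simp]: "v \<in> assigns M \<Longrightarrow> c \<in> univ M \<Longrightarrow> v(x := c) \<in> assigns M"
  by (auto simp: assigns_def)

lemma assignsD [simp]: "v \<in> assigns M \<Longrightarrow> v i \<in> univ M"
  by (auto simp: assigns_def)

lemma assigns_const [simp]: "(\<lambda>_. a) \<in> assigns M \<longleftrightarrow> a \<in> univ M"
  by (auto simp: assigns_def)

lemma assigns_comp [simp]: "v \<in> assigns M \<Longrightarrow> v \<circ> \<sigma> \<in> assigns M"
  by (auto simp: assigns_def)

locale cont_structure =
  fixes L :: "'r language" and M :: "('r, 'a) struct"
  assumes language: "is_language L" and is_struct: "is_structure L M"
begin

sublocale Metric_space "univ M" "mdist_of L M"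
  using is_struct by (simp add: is_structure_def)

lemma univ_nonempty: "univ M \<noteq> {}"
  using is_struct by (simp add: is_structure_def)

lemma expect_scale:
  "v \<in> assigns M \<Longrightarrow> wf_fm L \<phi> \<Longrightarrow>
    val M (Expect x (Scale_fm c \<phi>)) v = c * val M (Expect x \<phi>) v"
  using is_struct unfolding is_structure_def expectation_axioms_def by blast

lemma expect_plus:
  "v \<in> assigns M \<Longrightarrow> wf_fm L \<phi> \<Longrightarrow> wf_fm L \<psi> \<Longrightarrow>
    val M (Expect x (Plus_fm \<phi> \<psi>)) v = val M (Expect x \<phi>) v + val M (Expect x \<psi>) v"
  using is_struct unfolding is_structure_def expectation_axioms_def by blast

lemma expect_upper:
  assumes "v \<in> assigns M" "wf_fm L \<phi>" "\<And>c. c \<in> univ M \<Longrightarrow> val M \<phi> (v(x := c)) \<le> B"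
  shows "val M (Expect x \<phi>) v \<le> B"
proof -
  have "val M (Expect x \<phi>) v \<le> (SUP c\<in>univ M. val M \<phi> (v(x := c)))"
    using is_struct assms unfolding is_structure_def expectation_axioms_def by blast
  also have "\<dots> \<le> B"
    by (rule cSUP_least[OF univ_nonempty assms(3)])
  finally show ?thesis .
qed

text \<open>This replaces the missing existential quantifier: witnesses in the other model are
  extracted from positive expectations.\<close>

lemma expect_pos_imp_ex:
  assumes "v \<in> assigns M" "wf_fm L \<phi>" "val M (Expect x \<phi>) v > 0"
  obtains c where "c \<in> univ M" "val M \<phi> (v(x := c)) > 0"
  using expect_upper[OF assms(1,2), of x 0] assms(3) by (meson not_le)

text \<open>The axioms only compare expectations of formulas at the same parameters. Renaming the
  variables apart makes \<open>v\<close> and \<open>w\<close> parts of a single assignment.\<close>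

lemma expect_le:
  assumes v: "v \<in> assigns M" and w: "w \<in> assigns M" and wf: "wf_fm L \<phi>" "wf_fm L \<psi>"
    and le: "\<And>c. c \<in> univ M \<Longrightarrow> val M \<phi> (v(x := c)) \<le> K * val M \<psi> (w(y := c)) + e"
  shows "val M (Expect x \<phi>) v \<le> K * val M (Expect y \<psi>) w + e"
proof -
  \<comment> \<open>Both quantified variables go to 0, the other variables of \<phi> to odd numbers
    and those of \<psi> to positive even ones; \<open>s\<close> reads \<open>v\<close> off the odd
    and \<open>w\<close> off the even positions.\<close>
  define \<sigma> where "\<sigma> = (\<lambda>i. if i = x then 0 else Suc (2 * i))"
  define \<tau> where "\<tau> = (\<lambda>i. if i = y then 0 else Suc (Suc (2 * i)))"
  define s where "s = (\<lambda>i. if odd i then v (i div 2) else w ((i - 2) div 2))"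
  have inj: "inj \<sigma>" "inj \<tau>"
    by (auto simp: inj_def \<sigma>_def \<tau>_def)
  have s: "s \<in> assigns M"
    using v w by (auto simp: s_def assigns_def)
  have sv: "s(0 := c) \<circ> \<sigma> = v(x := c)" and sw: "s(0 := c) \<circ> \<tau> = w(y := c)" for c
    by (auto simp: s_def \<sigma>_def \<tau>_def fun_eq_iff)
  have E: "val M (Expect x \<phi>) v = val M (Expect 0 (ren \<sigma> \<phi>)) s"
    "val M (Expect y \<psi>) w = val M (Expect 0 (ren \<tau> \<psi>)) s"
    using sv sw inj by (simp_all add: val_ren)
  have "val M (Expect 0 (Plus_fm (ren \<sigma> \<phi>) (Scale_fm (- K) (ren \<tau> \<psi>)))) s \<le> e"
    by (rule expect_upper) (use s wf sv sw inj le in \<open>auto simp: val_ren algebra_simps\<close>)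
  then show ?thesis
    using s wf by (simp only: expect_plus expect_scale wf_ren wf_Scale E)
qed

lemma expect_abs_le:
  assumes "v \<in> assigns M" "w \<in> assigns M" "wf_fm L \<phi>"
    "\<And>c. c \<in> univ M \<Longrightarrow> \<bar>val M \<phi> (v(x := c)) - val M \<phi> (w(x := c))\<bar> \<le> e"
  shows "\<bar>val M (Expect x \<phi>) v - val M (Expect x \<phi>) w\<bar> \<le> e"
  using expect_le[of v w \<phi> \<phi> x 1 x e] expect_le[of w v \<phi> \<phi> x 1 x e] assms
  by (smt (verit))

text \<open>A connective is merely continuous; uniform continuity holds on compact cubes, and this
  bound keeps the arguments inside one.\<close>

lemma val_bounded: "wf_fm L \<phi> \<Longrightarrow> \<exists>B. \<forall>v\<in>assigns M. \<bar>val M \<phi> v\<bar> \<le> B"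
proof (induction \<phi>)
  case (Rel R xs)
  have "\<bar>rel M R (map v xs)\<bar> \<le> bound L R" if "v \<in> assigns M" for v
  proof -
    have "map v xs \<in> lists (univ M)" using that by auto
    then show ?thesis
      using is_struct Rel unfolding is_structure_def by (metis length_map wf_fm.simps(1))
  qed
  then show ?case by auto
next
  case (Conn u \<phi>s)
  then have "\<forall>\<phi>\<in>set \<phi>s. \<exists>B. \<forall>v\<in>assigns M. \<bar>val M \<phi> v\<bar> \<le> B"
    by simp
  then obtain B where B: "\<And>\<phi> v. \<phi> \<in> set \<phi>s \<Longrightarrow> v \<in> assigns M \<Longrightarrow> \<bar>val M \<phi> v\<bar> \<le> B \<phi>"
    by metis
  have B': "\<bar>val M \<phi> v\<bar> \<le> Max (B ` set \<phi>s)" if "\<phi> \<in> set \<phi>s" "v \<in> assigns M" for \<phi> v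
    using B[OF that] that by (meson List.finite_set Max_ge finite_imageI image_eqI order_trans)
  have cont: "continuous_on UNIV (\<lambda>t :: nat \<Rightarrow> real. u (map t [0..<length \<phi>s]))"
    using Conn.prems by simp
  from connective_bounded[OF cont, of "Max (B ` set \<phi>s)"] obtain C where C: "\<forall>xs. length xs = length \<phi>s \<longrightarrow>
      (\<forall>i<length \<phi>s. \<bar>xs ! i\<bar> \<le> Max (B ` set \<phi>s)) \<longrightarrow> \<bar>u xs\<bar> \<le> C"
    by (elim exE)
  have "\<bar>val M (Conn u \<phi>s) v\<bar> \<le> C" if "v \<in> assigns M" for v
    unfolding val.simps by (rule C[rule_format]) (use that in \<open>auto intro!: B'\<close>)
  then show ?case by blast
next
  case (Expect x \<phi>)
  then obtain B where B: "\<And>v. v \<in> assigns M \<Longrightarrow> \<bar>val M \<phi> v\<bar> \<le> B" by auto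
  have "\<bar>val M (Expect x \<phi>) v\<bar> \<le> B" if v: "v \<in> assigns M" for v
  proof -
    have Bc: "\<bar>val M \<phi> (v(x := c))\<bar> \<le> B" if "c \<in> univ M" for c
      using B v that by simp
    have "val M (Expect x \<phi>) v \<le> B"
      by (rule expect_upper) (use v Expect.prems Bc in \<open>auto simp: abs_le_iff\<close>)
    \<comment> \<open>The lower bound on the expectation of \<phi> is the upper bound for its
      negative.\<close>
    moreover have "val M (Expect x (Scale_fm (-1) \<phi>)) v \<le> B"
      by (rule expect_upper) (use v Expect.prems Bc in \<open>auto simp: abs_le_iff\<close>)
    ultimately show ?thesis
      using v Expect.prems by (auto simp: expect_scale abs_le_iff simp del: val.simps)
  qed
  then show ?case by blast
qed

text \<open>A connective takes the least modulus of its finitely many arguments. A quantifier keeps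
  the modulus of its body, because both assignments get the same value at the quantified
  variable.\<close>

lemma val_uniformly_continuous:
  "wf_fm L \<phi> \<Longrightarrow> \<epsilon> > 0 \<Longrightarrow>
    \<exists>\<delta>>0. \<forall>v\<in>assigns M. \<forall>w\<in>assigns M. (\<forall>i\<in>fv \<phi>. mdist_of L M (v i) (w i) < \<delta>) \<longrightarrow>
      \<bar>val M \<phi> v - val M \<phi> w\<bar> \<le> \<epsilon>"
proof (induction \<phi> arbitrary: \<epsilon>)
  case (Rel R xs)
  have pos: "modulus L R \<epsilon> > 0"
    using language Rel by (simp add: is_language_def)
  show ?case
  proof (intro exI[of _ "modulus L R \<epsilon>"] conjI ballI impI pos)
    fix v w assume "v \<in> assigns M" "w \<in> assigns M"
      "\<forall>i\<in>fv (Rel R xs). mdist_of L M (v i) (w i) < modulus L R \<epsilon>"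
    then have "map v xs \<in> lists (univ M)" "map w xs \<in> lists (univ M)"
      "\<forall>i<arity L R. mdist_of L M (map v xs ! i) (map w xs ! i) < modulus L R \<epsilon>"
      using Rel by auto
    moreover have "length (map v xs) = arity L R" "length (map w xs) = arity L R"
      using Rel by auto
    ultimately show "\<bar>val M (Rel R xs) v - val M (Rel R xs) w\<bar> \<le> \<epsilon>"
      using is_struct Rel.prems(2) unfolding is_structure_def val.simps by blast
  qed
next
  case (Conn u \<phi>s)
  have "\<exists>B. \<forall>v\<in>assigns M. \<bar>val M \<phi> v\<bar> \<le> B" if "\<phi> \<in> set \<phi>s" for \<phi>
    using val_bounded Conn.prems that by simp
  then obtain B where B: "\<And>\<phi> v. \<phi> \<in> set \<phi>s \<Longrightarrow> v \<in> assigns M \<Longrightarrow> \<bar>val M \<phi> v\<bar> \<le> B \<phi>"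
    by metis
  have B': "\<bar>val M \<phi> v\<bar> \<le> Max (B ` set \<phi>s)" if "\<phi> \<in> set \<phi>s" "v \<in> assigns M" for \<phi> v
    using B[OF that] that by (meson List.finite_set Max_ge finite_imageI image_eqI order_trans)
  have cont: "continuous_on UNIV (\<lambda>t :: nat \<Rightarrow> real. u (map t [0..<length \<phi>s]))"
    using Conn.prems by simp
  from connective_uniformly_continuous[OF cont Conn.prems(2), of "Max (B ` set \<phi>s)"]
  obtain \<eta> where \<eta>: "\<eta> > 0" "\<forall>xs ys. length xs = length \<phi>s \<longrightarrow> length ys = length \<phi>s \<longrightarrow>
      (\<forall>i<length \<phi>s. \<bar>xs ! i\<bar> \<le> Max (B ` set \<phi>s) \<and> \<bar>ys ! i\<bar> \<le> Max (B ` set \<phi>s) \<and>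
        \<bar>xs ! i - ys ! i\<bar> \<le> \<eta>) \<longrightarrow> \<bar>u xs - u ys\<bar> \<le> \<epsilon>"
    by (elim exE conjE)
  have "\<forall>\<phi>\<in>set \<phi>s. \<exists>\<delta>>0. \<forall>v\<in>assigns M. \<forall>w\<in>assigns M.
      (\<forall>i\<in>fv \<phi>. mdist_of L M (v i) (w i) < \<delta>) \<longrightarrow> \<bar>val M \<phi> v - val M \<phi> w\<bar> \<le> \<eta>"
    using Conn.IH[OF _ _ \<eta>(1)] Conn.prems(1) by (meson wf_fm.simps(2))
  from bchoice[OF this] obtain \<delta> where \<delta>: "\<forall>\<phi>\<in>set \<phi>s. \<delta> \<phi> > 0 \<and>
      (\<forall>v\<in>assigns M. \<forall>w\<in>assigns M. (\<forall>i\<in>fv \<phi>. mdist_of L M (v i) (w i) < \<delta> \<phi>) \<longrightarrow>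
        \<bar>val M \<phi> v - val M \<phi> w\<bar> \<le> \<eta>)"
    by (elim exE)
  \<comment> \<open>The 1 covers a connective without arguments.\<close>
  define \<delta>0 where "\<delta>0 = Min (insert 1 (\<delta> ` set \<phi>s))"
  have pos: "\<delta>0 > 0" using \<delta> by (simp add: \<delta>0_def)
  have le: "\<delta>0 \<le> \<delta> \<phi>" if "\<phi> \<in> set \<phi>s" for \<phi>
    using that by (simp add: \<delta>0_def)
  show ?case
  proof (intro exI[of _ \<delta>0] conjI ballI impI pos)
    fix v w assume v: "v \<in> assigns M" "w \<in> assigns M"
      and d: "\<forall>i\<in>fv (Conn u \<phi>s). mdist_of L M (v i) (w i) < \<delta>0"
    show "\<bar>val M (Conn u \<phi>s) v - val M (Conn u \<phi>s) w\<bar> \<le> \<epsilon>"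
      unfolding val.simps
    proof (rule \<eta>(2)[rule_format])
      fix i assume i: "i < length \<phi>s"
      then have "\<phi>s ! i \<in> set \<phi>s" by simp
      moreover have "\<forall>j\<in>fv (\<phi>s ! i). mdist_of L M (v j) (w j) < \<delta> (\<phi>s ! i)"
        using d i le[of "\<phi>s ! i"] by fastforce
      ultimately have "\<bar>val M (\<phi>s ! i) v - val M (\<phi>s ! i) w\<bar> \<le> \<eta>"
        using bspec[OF bspec[OF conjunct2[OF bspec[OF \<delta>]] v(1)] v(2)] by blast
      then show "\<bar>map (\<lambda>\<phi>. val M \<phi> v) \<phi>s ! i\<bar> \<le> Max (B ` set \<phi>s) \<and>
          \<bar>map (\<lambda>\<phi>. val M \<phi> w) \<phi>s ! i\<bar> \<le> Max (B ` set \<phi>s) \<and>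
          \<bar>map (\<lambda>\<phi>. val M \<phi> v) \<phi>s ! i - map (\<lambda>\<phi>. val M \<phi> w) \<phi>s ! i\<bar> \<le> \<eta>"
        using i v B' by simp
    qed auto
  qed
next
  case (Expect x \<phi>)
  have "wf_fm L \<phi>" using Expect.prems by simp
  from Expect.IH[OF this Expect.prems(2)] obtain \<delta> where pos: "\<delta> > 0"
    and \<delta>: "\<forall>v\<in>assigns M. \<forall>w\<in>assigns M. (\<forall>i\<in>fv \<phi>. mdist_of L M (v i) (w i) < \<delta>) \<longrightarrow>
      \<bar>val M \<phi> v - val M \<phi> w\<bar> \<le> \<epsilon>"
    by (elim exE conjE)
  show ?case
  proof (intro exI[of _ \<delta>] conjI ballI impI pos)
    fix v w assume v: "v \<in> assigns M" "w \<in> assigns M"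
      and d: "\<forall>i\<in>fv (Expect x \<phi>). mdist_of L M (v i) (w i) < \<delta>"
    show "\<bar>val M (Expect x \<phi>) v - val M (Expect x \<phi>) w\<bar> \<le> \<epsilon>"
    proof (rule expect_abs_le[OF v \<open>wf_fm L \<phi>\<close>])
      fix c assume c: "c \<in> univ M"
      have "\<forall>i\<in>fv \<phi>. mdist_of L M ((v(x := c)) i) ((w(x := c)) i) < \<delta>"
        using d c pos by auto
      then show "\<bar>val M \<phi> (v(x := c)) - val M \<phi> (w(x := c))\<bar> \<le> \<epsilon>"
        by (rule bspec[OF bspec[OF \<delta> assigns_upd[OF v(1) c]] assigns_upd[OF v(2) c], THEN mp])
    qed
  qed
qed

end

section \<open>Masses of balls\<close>

text \<open>\<open>mass L M \<epsilon> y\<close> is a definable stand-in for the measure of the \<open>\<epsilon>\<close>-ball around \<open>y\<close>.\<close>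

definition bump :: "'r language \<Rightarrow> real \<Rightarrow> 'r fm" where
  "bump L \<epsilon> = Conn (\<lambda>t. max 0 (\<epsilon> - t ! 0)) [metric L]"

definition mass :: "'r language \<Rightarrow> ('r, 'a) struct \<Rightarrow> real \<Rightarrow> 'a \<Rightarrow> real" where
  "mass L M \<epsilon> y = val M (Expect 0 (bump L \<epsilon>)) (\<lambda>_. y)"

text \<open>The centre of the bump, variable 1, becomes \<open>n\<close>, the variable of the point
  to be realized; all others move beyond \<open>n\<close>, which keeps the renaming injective. The
  mass of a point thereby becomes part of its type.\<close>

definition mass_fm :: "'r language \<Rightarrow> nat \<Rightarrow> real \<Rightarrow> 'r fm" where
  "mass_fm L n \<epsilon> = ren (\<lambda>i. if i = 1 then n else Suc (n + i)) (Expect 0 (bump L \<epsilon>))"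

section \<open>Bumps and distances evaluated on types\<close>

lemma type_approx:
  assumes "p \<in> types_over L M x" "F \<subseteq> fm_over L M" "finite F" "\<epsilon> > 0"
  obtains c where "c \<in> univ M" "\<And>\<phi> v. (\<phi>, v) \<in> F \<Longrightarrow> \<bar>val M \<phi> (v(x := c)) - p (\<phi>, v)\<bar> < \<epsilon>"
proof -
  have "\<exists>c\<in>univ M. \<forall>(\<phi>, v)\<in>F. \<bar>val M \<phi> (v(x := c)) - p (\<phi>, v)\<bar> < \<epsilon>"
    using assms unfolding types_over_def by blast
  then obtain c where c: "c \<in> univ M" "\<forall>(\<phi>, v)\<in>F. \<bar>val M \<phi> (v(x := c)) - p (\<phi>, v)\<bar> < \<epsilon>"
    by blast
  show thesis by (rule that[OF c(1)]) (use c(2) in auto)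
qed

context cont_structure
begin

lemma wf_metric: "wf_fm L (metric L)" and fv_metric: "fv (metric L) \<subseteq> {0, 1}"
  using language by (auto simp: is_language_def)

lemma wf_bump [simp]: "wf_fm L (bump L \<epsilon>)"
  using wf_metric by (auto simp: bump_def intro!: continuous_intros)

lemma fv_bump: "fv (bump L \<epsilon>) \<subseteq> {0, 1}"
  using fv_metric by (simp add: bump_def)

lemma val_metric: "v \<in> assigns M \<Longrightarrow> val M (metric L) v = mdist_of L M (v 0) (v 1)"
  using fv_metric by (auto simp: mdist_of_def intro!: val_cong)

lemma val_bump: "v \<in> assigns M \<Longrightarrow> val M (bump L \<epsilon>) v = max 0 (\<epsilon> - mdist_of L M (v 0) (v 1))"
  by (simp add: bump_def val_metric)

lemma wf_mass_fm [simp]: "wf_fm L (mass_fm L n \<epsilon>)"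
  by (simp add: mass_fm_def)

lemma inj_mass_ren: "inj (\<lambda>i. if i = 1 then n else Suc (n + i))"
  by (auto simp: inj_def)

lemma fv_mass_fm: "fv (mass_fm L n \<epsilon>) \<subseteq> {n}"
  unfolding mass_fm_def fv_ren[OF inj_mass_ren] using fv_bump[of \<epsilon>] by auto

lemma val_mass_fm: "val M (mass_fm L n \<epsilon>) v = mass L M \<epsilon> (v n)"
  unfolding mass_fm_def mass_def val_ren[OF inj_mass_ren]
  by (rule val_cong) (use fv_bump[of \<epsilon>] in auto)

text \<open>The metric may contain bound variables other than 0 and 1; for k at least 2 the index i
  + j + k exceeds both \<open>i\<close> and \<open>j\<close>, so the renaming is injective.\<close>

lemma mdist_of_formula:
  assumes "v \<in> assigns M" "i \<noteq> j"
  shows "val M (ren (\<lambda>k. if k = 0 then i else if k = 1 then j else i + j + k) (metric L)) v =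
    mdist_of L M (v i) (v j)"
proof -
  have "inj (\<lambda>k. if k = 0 then i else if k = 1 then j else i + j + k)"
    using assms(2) by (auto simp: inj_def split: if_splits)
  then show ?thesis
    using assms by (simp add: val_ren val_metric)
qed

text \<open>Evaluation at a formula is a coordinate projection, hence continuous. It is bounded
  because a type is approximated by points of \<open>M\<close>, where the formula is
  bounded.\<close>

lemma integrable_eval:
  assumes "induced_measure L M 0 \<mu>" "wf_fm L \<phi>" "v \<in> assigns M"
  shows "integrable \<mu> (\<lambda>p. p (\<phi>, v))"
proof -
  have sp: "space \<mu> = types_over L M 0" "sets \<mu> = sets (restrict_space borel (types_over L M 0))"
    using assms(1) by (auto simp: induced_measure_def regular_borel_on_def)
  interpret prob_space \<mu>
    using assms(1) by (simp add: induced_measure_def)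
  obtain B where B: "\<And>v. v \<in> assigns M \<Longrightarrow> \<bar>val M \<phi> v\<bar> \<le> B"
    using val_bounded[OF assms(2)] by blast
  have "\<bar>p (\<phi>, v)\<bar> \<le> B + 1" if p: "p \<in> types_over L M 0" for p
  proof -
    obtain c where "c \<in> univ M" "\<bar>val M \<phi> (v(0 := c)) - p (\<phi>, v)\<bar> < 1"
      by (rule type_approx[OF p, of "{(\<phi>, v)}" 1]) (use assms in \<open>auto simp: fm_over_def\<close>)
    then show ?thesis using B[of "v(0 := c)"] assms(3) by simp
  qed
  moreover have "(\<lambda>p. p (\<phi>, v)) \<in> borel_measurable \<mu>"
  proof -
    have "(\<lambda>p :: 'r fm \<times> (nat \<Rightarrow> 'a) \<Rightarrow> real. p (\<phi>, v)) \<in> borel_measurable borel"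
      by (intro borel_measurable_continuous_onI continuous_on_product_coordinates)
    then have "(\<lambda>p. p (\<phi>, v)) \<in> borel_measurable (restrict_space borel (types_over L M 0))"
      by (rule measurable_restrict_space1)
    then show ?thesis by (simp add: measurable_cong_sets[OF sp(2) refl])
  qed
  ultimately show ?thesis
    by (intro integrable_const_bound[of _ "B + 1"]) (auto simp: sp(1))
qed

lemma mass_eq_integral:
  assumes "induced_measure L M 0 \<mu>" "y \<in> univ M"
  shows "mass L M \<epsilon> y = (\<integral>p. p (bump L \<epsilon>, \<lambda>_. y) \<partial>\<mu>)"
  using assms by (fastforce simp: induced_measure_def mass_def fm_over_def simp del: val.simps)

text \<open>Both values are approximated at one common point \<open>c\<close>, where the identity
  holds. The function max 0 (\<epsilon> - t) is 1-Lipschitz, so the two errors of e/2 add up to at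
  most e.\<close>

lemma type_bump:
  assumes p: "p \<in> types_over L M 0" and y: "y \<in> univ M"
  shows "p (bump L \<epsilon>, \<lambda>_. y) = max 0 (\<epsilon> - p (metric L, \<lambda>_. y))"
proof -
  have "\<bar>p (bump L \<epsilon>, \<lambda>_. y) - max 0 (\<epsilon> - p (metric L, \<lambda>_. y))\<bar> \<le> 0 + e" if "e > 0" for e
  proof -
    have F: "{(bump L \<epsilon>, \<lambda>_. y), (metric L, \<lambda>_. y)} \<subseteq> fm_over L M"
      using wf_metric y by (simp add: fm_over_def)
    obtain c where c: "c \<in> univ M"
      "\<And>\<phi> v. (\<phi>, v) \<in> {(bump L \<epsilon>, \<lambda>_. y), (metric L, \<lambda>_. y)} \<Longrightarrow>
         \<bar>val M \<phi> (v(0 := c)) - p (\<phi>, v)\<bar> < e / 2"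
      by (rule type_approx[OF p F, of "e / 2"]) (use \<open>e > 0\<close> in auto)
    have v: "(\<lambda>_. y)(0 := c) \<in> assigns M" using c y by (intro assigns_upd) auto
    have "\<bar>val M (bump L \<epsilon>) ((\<lambda>_. y)(0 := c)) - p (bump L \<epsilon>, \<lambda>_. y)\<bar> < e / 2"
      "\<bar>val M (metric L) ((\<lambda>_. y)(0 := c)) - p (metric L, \<lambda>_. y)\<bar> < e / 2"
      by (rule c(2); simp)+
    then show ?thesis
      unfolding val_bump[OF v] val_metric[OF v] by linarith
  qed
  then have "\<bar>p (bump L \<epsilon>, \<lambda>_. y) - max 0 (\<epsilon> - p (metric L, \<lambda>_. y))\<bar> \<le> 0"
    by (rule field_le_epsilon)
  then show ?thesis by simp
qed

text \<open>A point within \<epsilon> of one centre is at distance at least \<epsilon> from all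
  others, so at most one summand is nonzero.\<close>

lemma sum_bumps_le:
  assumes "finite F" "F \<subseteq> univ M" "c \<in> univ M" "\<epsilon> > 0"
    and sep: "\<And>y z. y \<in> F \<Longrightarrow> z \<in> F \<Longrightarrow> y \<noteq> z \<Longrightarrow> mdist_of L M y z \<ge> 2 * \<epsilon>"
  shows "(\<Sum>y\<in>F. max 0 (\<epsilon> - mdist_of L M c y)) \<le> \<epsilon>"
proof (cases "\<exists>y\<in>F. mdist_of L M c y < \<epsilon>")
  case True
  then obtain y where y: "y \<in> F" "mdist_of L M c y < \<epsilon>" by blast
  have "max 0 (\<epsilon> - mdist_of L M c z) = 0" if "z \<in> F - {y}" for z
  proof -
    have "2 * \<epsilon> \<le> mdist_of L M y z" using sep y that by auto
    also have "\<dots> \<le> mdist_of L M y c + mdist_of L M c z"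
      using triangle y that assms by (meson DiffD1 subsetD)
    finally show ?thesis using y commute[of y c] by simp
  qed
  then have "(\<Sum>z\<in>F. max 0 (\<epsilon> - mdist_of L M c z)) = max 0 (\<epsilon> - mdist_of L M c y)"
    using assms(1) y(1) by (simp add: sum.remove[of F y])
  then show ?thesis using nonneg[of c y] \<open>\<epsilon> > 0\<close> by simp
next
  case False
  then have "(\<Sum>y\<in>F. max 0 (\<epsilon> - mdist_of L M c y)) = 0"
    by (intro sum.neutral) auto
  then show ?thesis using \<open>\<epsilon> > 0\<close> by simp
qed

end

section \<open>Consequences of full support: positive masses, packing, separability\<close>

locale full_structure = cont_structure L M
  for L :: "'r language" and M :: "('r, 'a) struct" +
  assumes full: "full_support L M" and complete: "complete_structure L M"
begin

lemma mass_pos: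
  assumes y: "y \<in> univ M" and "\<epsilon> > 0"
  shows "mass L M \<epsilon> y > 0"
proof -
  obtain \<mu> where \<mu>: "induced_measure L M 0 \<mu>"
    and pos: "measure \<mu> (type_ball L M y (\<epsilon> / 2)) > 0"
    using full assms unfolding full_support_def by (meson half_gt_zero)
  interpret prob_space \<mu>
    using \<mu> by (simp add: induced_measure_def)
  have sp: "space \<mu> = types_over L M 0"
    using \<mu> by (auto simp: induced_measure_def regular_borel_on_def)
  let ?A = "type_ball L M y (\<epsilon> / 2)"
  \<comment> \<open>Sets outside the sigma-algebra have measure 0, so positivity yields
    measurability.\<close>
  have A: "?A \<in> sets \<mu>"
    using pos measure_notin_sets by fastforce
  \<comment> \<open>On the ball of radius \<epsilon>/2 the bump of radius \<epsilon> is at least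
    \<epsilon>/2.\<close>
  have "0 < \<epsilon> / 2 * measure \<mu> ?A"
    using pos \<open>\<epsilon> > 0\<close> by simp
  also have "\<dots> = (\<integral>p. \<epsilon> / 2 * indicator ?A p \<partial>\<mu>)"
    using A by simp
  also have "\<dots> \<le> (\<integral>p. p (bump L \<epsilon>, \<lambda>_. y) \<partial>\<mu>)"
  proof (rule integral_mono)
    show "integrable \<mu> (\<lambda>p. \<epsilon> / 2 * indicator ?A p)"
      using A by (intro integrable_mult_right integrable_real_indicator) (auto simp: less_top[symmetric])
    show "integrable \<mu> (\<lambda>p. p (bump L \<epsilon>, \<lambda>_. y))"
      using y by (intro integrable_eval[OF \<mu>]) auto
    fix p assume "p \<in> space \<mu>"
    then have "p (bump L \<epsilon>, \<lambda>_. y) = max 0 (\<epsilon> - p (metric L, \<lambda>_. y))"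
      by (intro type_bump y) (simp add: sp)
    then show "\<epsilon> / 2 * indicator ?A p \<le> p (bump L \<epsilon>, \<lambda>_. y)"
      using \<open>\<epsilon> > 0\<close> by (auto simp: indicator_def type_ball_def)
  qed
  finally show ?thesis using mass_eq_integral[OF \<mu> y] by simp
qed

text \<open>Packing inequality: the sum of the bumps is at most \<epsilon> at points, hence at types
  by approximation, and the measure has total mass 1.\<close>

lemma sum_mass_le:
  assumes F: "finite F" "F \<subseteq> univ M" and "\<epsilon> > 0"
    and sep: "\<And>y z. y \<in> F \<Longrightarrow> z \<in> F \<Longrightarrow> y \<noteq> z \<Longrightarrow> mdist_of L M y z \<ge> 2 * \<epsilon>"
  shows "(\<Sum>y\<in>F. mass L M \<epsilon> y) \<le> \<epsilon>"
proof -
  obtain \<mu> where \<mu>: "induced_measure L M 0 \<mu>"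
    using full unfolding full_support_def by blast
  interpret prob_space \<mu>
    using \<mu> by (simp add: induced_measure_def)
  have sp: "space \<mu> = types_over L M 0"
    using \<mu> by (auto simp: induced_measure_def regular_borel_on_def)
  have int: "integrable \<mu> (\<lambda>p. p (bump L \<epsilon>, \<lambda>_. y))" if "y \<in> F" for y
    using that F by (intro integrable_eval[OF \<mu>]) auto
  have "(\<Sum>y\<in>F. mass L M \<epsilon> y) = (\<Sum>y\<in>F. \<integral>p. p (bump L \<epsilon>, \<lambda>_. y) \<partial>\<mu>)"
    by (intro sum.cong refl mass_eq_integral[OF \<mu>]) (use F in auto)
  also have "\<dots> = (\<integral>p. (\<Sum>y\<in>F. p (bump L \<epsilon>, \<lambda>_. y)) \<partial>\<mu>)"
    using int by simp
  also have "\<dots> \<le> (\<integral>p. \<epsilon> \<partial>\<mu>)"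
  proof (rule integral_mono)
    show "integrable \<mu> (\<lambda>p. \<Sum>y\<in>F. p (bump L \<epsilon>, \<lambda>_. y))"
      using int by simp
    fix p assume "p \<in> space \<mu>"
    then have p: "p \<in> types_over L M 0" by (simp add: sp)
    show "(\<Sum>y\<in>F. p (bump L \<epsilon>, \<lambda>_. y)) \<le> \<epsilon>"
    proof (rule field_le_epsilon)
      fix e :: real assume "e > 0"
      \<comment> \<open>The \<open>card F\<close> errors of size e/k sum to at most e; the successor
        avoids division by zero for empty \<open>F\<close>.\<close>
      define k where "k = real (Suc (card F))"
      have "k > 0" by (simp add: k_def)
      have F': "(\<lambda>y. (bump L \<epsilon>, \<lambda>_. y)) ` F \<subseteq> fm_over L M"
        using F by (auto simp: fm_over_def)
      obtain c where c: "c \<in> univ M" "\<And>\<phi> v. (\<phi>, v) \<in> (\<lambda>y. (bump L \<epsilon>, \<lambda>_. y)) ` F \<Longrightarrow>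
          \<bar>val M \<phi> (v(0 := c)) - p (\<phi>, v)\<bar> < e / k"
        by (rule type_approx[OF p F', of "e / k"]) (use F \<open>e > 0\<close> \<open>k > 0\<close> in auto)
      have "p (bump L \<epsilon>, \<lambda>_. y) \<le> max 0 (\<epsilon> - mdist_of L M c y) + e / k" if "y \<in> F" for y
      proof -
        have v: "(\<lambda>_. y)(0 := c) \<in> assigns M"
          using c F that by (intro assigns_upd) auto
        have "\<bar>val M (bump L \<epsilon>) ((\<lambda>_. y)(0 := c)) - p (bump L \<epsilon>, \<lambda>_. y)\<bar> < e / k"
          using that by (intro c(2)) auto
        then show ?thesis unfolding val_bump[OF v] by simp
      qed
      then have "(\<Sum>y\<in>F. p (bump L \<epsilon>, \<lambda>_. y)) \<le>
          (\<Sum>y\<in>F. max 0 (\<epsilon> - mdist_of L M c y) + e / k)"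
        by (rule sum_mono)
      also have "\<dots> = (\<Sum>y\<in>F. max 0 (\<epsilon> - mdist_of L M c y)) + card F * (e / k)"
        by (simp add: sum.distrib)
      also have "\<dots> \<le> \<epsilon> + card F * (e / k)"
        using sum_bumps_le[OF F c(1) \<open>\<epsilon> > 0\<close> sep] by simp
      also have "card F * (e / k) \<le> e"
        using \<open>e > 0\<close> by (simp add: k_def field_simps)
      finally show "(\<Sum>y\<in>F. p (bump L \<epsilon>, \<lambda>_. y)) \<le> \<epsilon> + e" by simp
    qed
  qed simp
  finally show ?thesis by (simp add: prob_space)
qed

text \<open>Packing bounds the size of a separated set of points of mass at least \<eta> by
  \<epsilon>/\<eta>. A largest such set is a net, since a point far from it could be added.\<close>

lemma finite_net:
  assumes "\<epsilon> > 0" "\<eta> > 0"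
  obtains F where "finite F" "F \<subseteq> univ M"
    "\<And>y. y \<in> univ M \<Longrightarrow> mass L M \<epsilon> y \<ge> \<eta> \<Longrightarrow> \<exists>z\<in>F. mdist_of L M y z < 2 * \<epsilon>"
proof -
  define P where "P F \<longleftrightarrow> finite F \<and> F \<subseteq> univ M \<and> (\<forall>y\<in>F. mass L M \<epsilon> y \<ge> \<eta>) \<and>
    (\<forall>y\<in>F. \<forall>z\<in>F. y \<noteq> z \<longrightarrow> mdist_of L M y z \<ge> 2 * \<epsilon>)" for F
  have "card F < Suc (nat \<lfloor>\<epsilon> / \<eta>\<rfloor>)" if "P F" for F
  proof -
    have "card F * \<eta> \<le> (\<Sum>y\<in>F. mass L M \<epsilon> y)"
      using that by (intro sum_bounded_below) (auto simp: P_def)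
    also have "\<dots> \<le> \<epsilon>"
      using that by (intro sum_mass_le assms) (auto simp: P_def)
    finally have "card F \<le> \<epsilon> / \<eta>" using assms by (simp add: field_simps)
    then have "card F \<le> nat \<lfloor>\<epsilon> / \<eta>\<rfloor>" by linarith
    then show ?thesis by simp
  qed
  moreover have "P {}" by (simp add: P_def)
  ultimately obtain F where F: "P F" and max: "\<And>F'. P F' \<Longrightarrow> card F' \<le> card F"
    using ex_has_greatest_nat[of P "{}" card] by blast
  show thesis
  proof (rule that)
    show "finite F" "F \<subseteq> univ M" using F by (auto simp: P_def)
    fix y assume y: "y \<in> univ M" "mass L M \<epsilon> y \<ge> \<eta>"
    show "\<exists>z\<in>F. mdist_of L M y z < 2 * \<epsilon>"
    proof (rule ccontr)
      assume "\<not> ?thesis"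
      then have far: "\<forall>z\<in>F. mdist_of L M y z \<ge> 2 * \<epsilon>" "\<forall>z\<in>F. mdist_of L M z y \<ge> 2 * \<epsilon>"
        using commute by (metis not_less)+
      have "mdist_of L M y y < 2 * \<epsilon>" using y assms by simp
      then have "y \<notin> F" using far by force
      moreover have "P (insert y F)"
        using F y far by (simp add: P_def)
      ultimately show False using max[of "insert y F"] F by (simp add: P_def)
    qed
  qed
qed

text \<open>Every point has positive mass at every scale, so it is covered by the net for that scale
  and some threshold 1/(j+1). There are countably many such finite nets.\<close>

lemma separable:
  obtains D where "countable D" "D \<subseteq> univ M"
    "\<And>x \<delta>. x \<in> univ M \<Longrightarrow> \<delta> > 0 \<Longrightarrow> \<exists>y\<in>D. mdist_of L M x y < \<delta>"
proof -
  define Q where "Q i j F \<longleftrightarrow> finite F \<and> F \<subseteq> univ M \<and>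
    (\<forall>y\<in>univ M. mass L M (inverse (real (Suc i))) y \<ge> inverse (real (Suc j)) \<longrightarrow>
      (\<exists>z\<in>F. mdist_of L M y z < 2 * inverse (real (Suc i))))" for i j F
  define F where "F i j = (SOME F. Q i j F)" for i j
  have "\<exists>F. Q i j F" for i j
    unfolding Q_def
    by (rule finite_net[of "inverse (real (Suc i))" "inverse (real (Suc j))"]; auto)
  then have "Q i j (F i j)" for i j
    unfolding F_def by (rule someI_ex)
  then have F: "\<And>i j. finite (F i j)" "\<And>i j. F i j \<subseteq> univ M"
    "\<And>i j y. y \<in> univ M \<Longrightarrow> mass L M (inverse (real (Suc i))) y \<ge> inverse (real (Suc j)) \<Longrightarrow>
      \<exists>z\<in>F i j. mdist_of L M y z < 2 * inverse (real (Suc i))"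
    unfolding Q_def by blast+
  show thesis
  proof (rule that[of "\<Union>i j. F i j"])
    show "countable (\<Union>i j. F i j)"
      using F(1) by (intro countable_UN) (auto simp: uncountable_infinite countable_finite)
    show "(\<Union>i j. F i j) \<subseteq> univ M" using F(2) by blast
    fix x and \<delta> :: real assume x: "x \<in> univ M" and "\<delta> > 0"
    obtain i where i: "inverse (real (Suc i)) < \<delta> / 2"
      using reals_Archimedean[of "\<delta> / 2"] \<open>\<delta> > 0\<close> by auto
    obtain j where "inverse (real (Suc j)) < mass L M (inverse (real (Suc i))) x"
      using reals_Archimedean[OF mass_pos[OF x, of "inverse (real (Suc i))"]] by auto
    then obtain z where "z \<in> F i j" "mdist_of L M x z < 2 * inverse (real (Suc i))"
      using F(3)[OF x, of j i] by force
    then show "\<exists>y\<in>\<Union>i j. F i j. mdist_of L M x y < \<delta>"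
      using i by (intro bexI[of _ z]) auto
  qed
qed

text \<open>Approximations occur at arbitrarily large indices, also in a finite or discrete
  \<open>M\<close>: the second component of the decoded pair repeats each point infinitely often.
  Distinct variables can then later be given distinct indices.\<close>

lemma dense_enumeration:
  shows "\<exists>e :: nat \<Rightarrow> 'a. (\<forall>i. e i \<in> univ M) \<and>
    (\<forall>x\<in>univ M. \<forall>\<delta>>0. \<forall>m. \<exists>i\<ge>m. mdist_of L M (e i) x < \<delta>)"
proof -
  obtain D where D: "countable D" "D \<subseteq> univ M"
    "\<And>x \<delta>. x \<in> univ M \<Longrightarrow> \<delta> > 0 \<Longrightarrow> \<exists>y\<in>D. mdist_of L M x y < \<delta>"
    using separable by blast
  have "D \<noteq> {}"
    using D(3)[of _ 1] univ_nonempty by (metis all_not_in_conv zero_less_one)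
  define e where "e i = from_nat_into D (fst (prod_decode i))" for i
  show ?thesis
  proof (intro exI[of _ e] conjI allI ballI impI)
    show "e i \<in> univ M" for i
      using from_nat_into[OF \<open>D \<noteq> {}\<close>] D(2) by (auto simp: e_def)
    fix x and \<delta> :: real and m assume "x \<in> univ M" "\<delta> > 0"
    then obtain y where y: "y \<in> D" "mdist_of L M x y < \<delta>" using D(3) by blast
    then obtain k where "from_nat_into D k = y"
      using from_nat_into_surj[OF D(1)] by blast
    then have "e (prod_encode (k, m)) = y" by (simp add: e_def)
    then show "\<exists>i\<ge>m. mdist_of L M (e i) x < \<delta>"
      using y commute[of x y] le_prod_encode_2[of m k] by (intro exI[of _ "prod_encode (k, m)"]) auto
  qed
qed

text \<open>The Lindelof argument: there are countably many balls with centre in \<open>D\<close>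
  and radius 1/(k+1), and one \<phi> is chosen for each ball on which some \<phi> works
  throughout.\<close>

lemma countable_subfamily:
  assumes loc: "\<And>y. y \<in> univ M \<Longrightarrow>
    \<exists>\<phi>\<in>\<Phi>. \<exists>r>0. \<forall>z\<in>univ M. mdist_of L M y z < r \<longrightarrow> P \<phi> z"
  obtains \<Psi> where "countable \<Psi>" "\<Psi> \<subseteq> \<Phi>" "\<forall>y\<in>univ M. \<exists>\<phi>\<in>\<Psi>. P \<phi> y"
proof -
  obtain D where D: "countable D" "D \<subseteq> univ M"
    "\<And>x \<delta>. x \<in> univ M \<Longrightarrow> \<delta> > 0 \<Longrightarrow> \<exists>y\<in>D. mdist_of L M x y < \<delta>"
    using separable by blast
  define Q where "Q = (\<lambda>(e, k) \<phi>. \<phi> \<in> \<Phi> \<and>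
    (\<forall>z\<in>univ M. mdist_of L M e z < inverse (real (Suc k)) \<longrightarrow> P \<phi> z))"
  define I where "I = {i \<in> D \<times> UNIV. \<exists>\<phi>. Q i \<phi>}"
  define g where "g i = (SOME \<phi>. Q i \<phi>)" for i
  have g: "Q i (g i)" if "i \<in> I" for i
    using that by (auto simp: I_def g_def intro: someI_ex)
  show thesis
  proof (rule that[of "g ` I"])
    show "countable (g ` I)"
      using D(1) by (auto simp: I_def intro!: countable_image countable_Collect)
    show "g ` I \<subseteq> \<Phi>" using g by (auto simp: Q_def)
    show "\<forall>y\<in>univ M. \<exists>\<phi>\<in>g ` I. P \<phi> y"
    proof
      fix y assume y: "y \<in> univ M"
      then obtain \<phi> r where \<phi>: "\<phi> \<in> \<Phi>" "r > 0" "\<And>z. z \<in> univ M \<Longrightarrow> mdist_of L M y z < r \<Longrightarrow> P \<phi> z"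
        using loc by metis
      \<comment> \<open>The ball of radius 1/(k+1) around a centre that close to \<open>y\<close>
        contains \<open>y\<close> and lies inside the r-ball around \<open>y\<close>.\<close>
      obtain k where k: "inverse (real (Suc k)) < r / 2"
        using reals_Archimedean[of "r / 2"] \<open>r > 0\<close> by auto
      obtain e where e: "e \<in> D" "mdist_of L M y e < inverse (real (Suc k))"
        using D(3)[OF y, of "inverse (real (Suc k))"] by auto
      have "Q (e, k) \<phi>"
        unfolding Q_def prod.case
      proof (intro conjI ballI impI \<phi>)
        fix z assume z: "z \<in> univ M" "mdist_of L M e z < inverse (real (Suc k))"
        have "mdist_of L M y z \<le> mdist_of L M y e + mdist_of L M e z"
          using y z e D(2) by (intro triangle) auto
        then show "mdist_of L M y z < r" using e z k by linarith
      qed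
      then have "(e, k) \<in> I" using e by (auto simp: I_def)
      moreover have "P (g (e, k)) y"
        using g[OF calculation] y e commute[of y e] by (auto simp: Q_def)
      ultimately show "\<exists>\<phi>\<in>g ` I. P \<phi> y" by blast
    qed
  qed
qed

end

section \<open>Back and forth\<close>

text \<open>The first \<open>n\<close> entries have the same type. Assignments are total so that
  tuples of growing length live in one type; entries from \<open>n\<close> on are
  placeholders.\<close>

definition eqv ::
    "'r language \<Rightarrow> ('r, 'a) struct \<Rightarrow> ('r, 'b) struct \<Rightarrow> nat \<Rightarrow> (nat \<Rightarrow> 'a) \<Rightarrow> (nat \<Rightarrow> 'b) \<Rightarrow> bool" where
  "eqv L M N n v w \<longleftrightarrow> v \<in> assigns M \<and> w \<in> assigns N \<and>
     (\<forall>\<phi>. wf_fm L \<phi> \<longrightarrow> fv \<phi> \<subseteq> {..<n} \<longrightarrow> val M \<phi> v = val N \<phi> w)"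

lemma eqv_sym: "eqv L M N n v w \<Longrightarrow> eqv L N M n w v"
  by (simp add: eqv_def)

lemma eqv_cong:
  assumes "eqv L M N n v w" "v' \<in> assigns M" "w' \<in> assigns N"
    "\<And>i. i < n \<Longrightarrow> v' i = v i" "\<And>i. i < n \<Longrightarrow> w' i = w i"
  shows "eqv L M N n v' w'"
  unfolding eqv_def
proof (intro conjI allI impI assms)
  fix \<phi> :: "'a fm" assume \<phi>: "wf_fm L \<phi>" "fv \<phi> \<subseteq> {..<n}"
  have "val M \<phi> v' = val M \<phi> v" "val N \<phi> w' = val N \<phi> w"
    using \<phi> assms by (auto intro!: val_cong)
  then show "val M \<phi> v' = val N \<phi> w'"
    using assms(1) \<phi> by (simp add: eqv_def)
qed

section \<open>Realizing types in the other model\<close>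

lemma approximate_realization:
  assumes M: "full_structure L M" and N: "full_structure L N"
    and eqv: "eqv L M N n v w" and c: "c \<in> univ M"
    and \<phi>s: "\<And>\<phi>. \<phi> \<in> set \<phi>s \<Longrightarrow> wf_fm L \<phi> \<and> fv \<phi> \<subseteq> {..n}" and "\<epsilon> > 0"
  obtains y where "y \<in> univ N"
    "\<And>\<phi>. \<phi> \<in> set \<phi>s \<Longrightarrow> \<bar>val N \<phi> (w(n := y)) - val M \<phi> (v(n := c))\<bar> < \<epsilon>"
proof -
  interpret M: full_structure L M by (fact M)
  interpret N: full_structure L N by (fact N)
  have v: "v \<in> assigns M" and w: "w \<in> assigns N"
    using eqv by (auto simp: eqv_def)
  define r where "r i = val M (\<phi>s ! i) (v(n := c))" for i
  \<comment> \<open>\<open>g\<close> is positive exactly where the total error over all of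
    \<open>\<phi>s\<close> is below \<epsilon>, and it attains \<epsilon> at
    \<open>c\<close>.\<close>
  define g where "g = Conn (\<lambda>t. max 0 (\<epsilon> - (\<Sum>i<length \<phi>s. \<bar>t ! i - r i\<bar>))) \<phi>s"
  have "(\<lambda>t :: nat \<Rightarrow> real. max 0 (\<epsilon> - (\<Sum>i<length \<phi>s. \<bar>map t [0..<length \<phi>s] ! i - r i\<bar>))) =
      (\<lambda>t. max 0 (\<epsilon> - (\<Sum>i<length \<phi>s. \<bar>t i - r i\<bar>)))"
    by (intro ext arg_cong2[where f=max] arg_cong2[where f=minus] sum.cong refl) simp
  moreover have "continuous_on UNIV (\<lambda>t :: nat \<Rightarrow> real. max 0 (\<epsilon> - (\<Sum>i<length \<phi>s. \<bar>t i - r i\<bar>)))"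
    by (intro continuous_intros continuous_on_product_coordinates)
  ultimately have g: "wf_fm L g"
    using \<phi>s by (simp add: g_def)
  have fv: "fv (Expect n g) \<subseteq> {..<n}"
    using \<phi>s by (fastforce simp: g_def)
  have gc: "val M g (v(n := c)) = \<epsilon>"
    using \<open>\<epsilon> > 0\<close> by (simp add: g_def r_def)
  obtain \<delta> where \<delta>: "\<delta> > 0" "\<forall>v\<in>assigns M. \<forall>w\<in>assigns M.
      (\<forall>i\<in>fv g. mdist_of L M (v i) (w i) < \<delta>) \<longrightarrow> \<bar>val M g v - val M g w\<bar> \<le> \<epsilon> / 2"
    using M.val_uniformly_continuous[OF g half_gt_zero[OF \<open>\<epsilon> > 0\<close>]] by (elim exE conjE)
  \<comment> \<open>Within \<delta> of \<open>c\<close> the bump is at most \<delta> while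
    \<open>g\<close> is at least \<epsilon>/2, which gives the constant 2\<delta>/\<epsilon>;
    elsewhere the bump vanishes.\<close>
  have "val M (Expect 0 (bump L \<delta>)) (\<lambda>_. c) \<le> 2 * \<delta> / \<epsilon> * val M (Expect n g) v + 0"
  proof (rule M.expect_le)
    fix z assume z: "z \<in> univ M"
    have b: "val M (bump L \<delta>) ((\<lambda>_. c)(0 := z)) = max 0 (\<delta> - mdist_of L M z c)"
      using M.val_bump[of "(\<lambda>_. c)(0 := z)"] c z by simp
    show "val M (bump L \<delta>) ((\<lambda>_. c)(0 := z)) \<le> 2 * \<delta> / \<epsilon> * val M g (v(n := z)) + 0"
    proof (cases "mdist_of L M z c < \<delta>")
      case True
      have "\<bar>val M g (v(n := z)) - val M g (v(n := c))\<bar> \<le> \<epsilon> / 2"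
        by (rule \<delta>(2)[rule_format]) (use v c z True \<delta>(1) in auto)
      then have "\<epsilon> / 2 \<le> val M g (v(n := z))" unfolding gc by linarith
      then have "2 * \<delta> / \<epsilon> * (\<epsilon> / 2) \<le> 2 * \<delta> / \<epsilon> * val M g (v(n := z))"
        using \<delta>(1) \<open>\<epsilon> > 0\<close> by (intro mult_left_mono) auto
      moreover have "val M (bump L \<delta>) ((\<lambda>_. c)(0 := z)) \<le> \<delta>"
        using b M.nonneg[of z c] \<delta>(1) by simp
      ultimately show ?thesis using \<open>\<epsilon> > 0\<close> by simp
    next
      case False
      have "0 \<le> val M g (v(n := z))" by (simp add: g_def)
      then show ?thesis using b False \<open>\<epsilon> > 0\<close> \<delta>(1) by simp
    qed
  qed (use v c g in auto)
  moreover have "0 < val M (Expect 0 (bump L \<delta>)) (\<lambda>_. c)"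
    using M.mass_pos[OF c \<delta>(1)] by (simp add: mass_def)
  ultimately have "0 < 2 * \<delta> / \<epsilon> * val M (Expect n g) v" by linarith
  then have "0 < val M (Expect n g) v"
    using \<delta>(1) \<open>\<epsilon> > 0\<close> by (simp add: zero_less_mult_iff zero_less_divide_iff)
  \<comment> \<open>The passage from \<open>M\<close> to \<open>N\<close>: quantifying
    \<open>n\<close> leaves only variables below \<open>n\<close>, on which the types agree.\<close>
  also have "\<dots> = val N (Expect n g) w"
    using eqv fv g unfolding eqv_def by (metis wf_fm.simps(3))
  finally obtain y where y: "y \<in> univ N" "val N g (w(n := y)) > 0"
    using N.expect_pos_imp_ex[OF w g] by blast
  show thesis
  proof (rule that[OF y(1)])
    fix \<phi> assume "\<phi> \<in> set \<phi>s"
    then obtain i where i: "i < length \<phi>s" "\<phi> = \<phi>s ! i" by (metis in_set_conv_nth)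
    have "\<bar>val N \<phi> (w(n := y)) - r i\<bar> \<le> (\<Sum>i<length \<phi>s. \<bar>val N (\<phi>s ! i) (w(n := y)) - r i\<bar>)"
      using i member_le_sum[of i "{..<length \<phi>s}" "\<lambda>i. \<bar>val N (\<phi>s ! i) (w(n := y)) - r i\<bar>"] by simp
    also have "\<dots> < \<epsilon>"
      using y(2) by (simp add: g_def split: if_splits)
    finally show "\<bar>val N \<phi> (w(n := y)) - val M \<phi> (v(n := c))\<bar> < \<epsilon>"
      by (simp add: r_def i)
  qed
qed

text \<open>The masses of the balls around \<open>c\<close> bound from below those around good approximate
  realizations, which therefore form a totally bounded set.\<close>

lemma countable_realization:
  assumes M: "full_structure L M" and N: "full_structure L N"
    and eqv: "eqv L M N n v w" and c: "c \<in> univ M"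
    and \<Phi>: "countable \<Phi>" "\<And>\<phi>. \<phi> \<in> \<Phi> \<Longrightarrow> wf_fm L \<phi> \<and> fv \<phi> \<subseteq> {..n}"
  shows "\<exists>d\<in>univ N. \<forall>\<phi>\<in>\<Phi>. val N \<phi> (w(n := d)) = val M \<phi> (v(n := c))"
proof -
  interpret M: full_structure L M by (fact M)
  interpret N: full_structure L N by (fact N)
  have v: "v \<in> assigns M" and w: "w \<in> assigns N"
    using eqv by (auto simp: eqv_def)
  \<comment> \<open>The mass formulas are adjoined so that approximate realizations also inherit the
    masses of balls around \<open>c\<close>.\<close>
  define \<Psi> where "\<Psi> = \<Phi> \<union> range (\<lambda>k. mass_fm L n (inverse (real (Suc k))))"
  define \<psi> where "\<psi> = from_nat_into \<Psi>"
  have \<Psi>: "countable \<Psi>" "\<Psi> \<noteq> {}"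
    using \<Phi>(1) by (auto simp: \<Psi>_def)
  have \<psi>_surj: "\<exists>i. \<psi> i = \<phi>" if "\<phi> \<in> \<Psi>" for \<phi>
    using from_nat_into_surj[OF \<Psi>(1) that] by (simp add: \<psi>_def)
  have \<psi>: "wf_fm L (\<psi> i) \<and> fv (\<psi> i) \<subseteq> {..n}" for i
  proof -
    have "\<psi> i \<in> \<Psi>" using from_nat_into[OF \<Psi>(2)] by (simp add: \<psi>_def)
    then show ?thesis using \<Phi>(2) M.fv_mass_fm by (fastforce simp: \<Psi>_def)
  qed
  have "\<exists>y\<in>univ N. \<forall>i\<le>m. \<bar>val N (\<psi> i) (w(n := y)) - val M (\<psi> i) (v(n := c))\<bar> < inverse (real (Suc m))" for m
  proof -
    obtain y where "y \<in> univ N" "\<And>\<phi>. \<phi> \<in> set (map \<psi> [0..<Suc m]) \<Longrightarrow>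
        \<bar>val N \<phi> (w(n := y)) - val M \<phi> (v(n := c))\<bar> < inverse (real (Suc m))"
      by (rule approximate_realization[OF M N eqv c, of "map \<psi> [0..<Suc m]" "inverse (real (Suc m))"])
        (use \<psi> in auto)
    moreover have "\<psi> i \<in> set (map \<psi> [0..<Suc m])" if "i \<le> m" for i
      using that by (simp only: set_map set_upt) force
    ultimately show ?thesis by (intro bexI[of _ y]) blast+
  qed
  then obtain y where y: "\<And>m. y m \<in> univ N"
    "\<And>m i. i \<le> m \<Longrightarrow> \<bar>val N (\<psi> i) (w(n := y m)) - val M (\<psi> i) (v(n := c))\<bar> < inverse (real (Suc m))"
    by metis
  have "N.mtotally_bounded (range y)"
    unfolding N.mtotally_bounded_def
  proof (intro allI impI)
    fix \<epsilon> :: real assume "\<epsilon> > 0"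
    obtain k where k: "inverse (real (Suc k)) < \<epsilon> / 4"
      using reals_Archimedean[of "\<epsilon> / 4"] \<open>\<epsilon> > 0\<close> by auto
    define e where "e = inverse (real (Suc k))"
    define \<eta> where "\<eta> = mass L M e c"
    have "e > 0" by (simp add: e_def)
    then have "\<eta> > 0" using M.mass_pos[OF c] by (simp add: \<eta>_def)
    obtain j where j: "\<psi> j = mass_fm L n e"
      using \<psi>_surj[of "mass_fm L n e"] by (auto simp: \<Psi>_def e_def)
    obtain l where l: "inverse (real (Suc l)) < \<eta> / 2"
      using reals_Archimedean[of "\<eta> / 2"] \<open>\<eta> > 0\<close> by auto
    have mass: "mass L N e (y m) \<ge> \<eta> / 2" if "m \<ge> max j l" for m
    proof -
      have "\<bar>mass L N e (y m) - \<eta>\<bar> < inverse (real (Suc m))"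
        using y(2)[of j m] that by (simp add: j M.val_mass_fm N.val_mass_fm \<eta>_def)
      also have "\<dots> \<le> inverse (real (Suc l))" using that by simp
      finally show ?thesis using l by (simp add: abs_less_iff)
    qed
    obtain F where F: "finite F" "F \<subseteq> univ N"
      "\<And>y. y \<in> univ N \<Longrightarrow> mass L N e y \<ge> \<eta> / 2 \<Longrightarrow> \<exists>z\<in>F. mdist_of L N y z < 2 * e"
      using N.finite_net[OF \<open>e > 0\<close>, of "\<eta> / 2"] \<open>\<eta> > 0\<close> by (metis half_gt_zero)
    \<comment> \<open>Centres must belong to \<open>range y\<close>, so each net point is replaced
      by a nearby member of the sequence, at the cost of doubling the radius 2e to 4e, still below
      \<epsilon>. If no member is near, the choice is arbitrary but stays in the range.\<close>
    define p where "p z = y (SOME m. mdist_of L N (y m) z < 2 * e)" for z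
    have p: "p z \<in> range y" for z by (simp add: p_def)
    then have pN: "p z \<in> univ N" for z using y(1) by (metis imageE)
    define K where "K = y ` {..<max j l} \<union> p ` F"
    have "\<exists>x\<in>K. y m \<in> N.mball x \<epsilon>" for m
    proof (cases "m < max j l")
      case True
      then show ?thesis using y(1) \<open>\<epsilon> > 0\<close> by (intro bexI[of _ "y m"]) (auto simp: K_def)
    next
      case False
      then have "mass L N e (y m) \<ge> \<eta> / 2" by (intro mass) linarith
      then obtain z where z: "z \<in> F" "mdist_of L N (y m) z < 2 * e"
        using F(3)[OF y(1)] by blast
      from z(2) have pz: "mdist_of L N (p z) z < 2 * e"
        unfolding p_def by (rule someI)
      have "mdist_of L N (p z) (y m) \<le> mdist_of L N (p z) z + mdist_of L N z (y m)"
        using z y(1) F(2) pN by (intro N.triangle) auto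
      also have "\<dots> < \<epsilon>"
        using pz z k N.commute[of z "y m"] by (simp add: e_def)
      finally show ?thesis
        using z y(1) pN by (intro bexI[of _ "p z"]) (auto simp: K_def)
    qed
    then have "range y \<subseteq> (\<Union>x\<in>K. N.mball x \<epsilon>)" by blast
    moreover have "finite K"
      using F(1) by (simp add: K_def)
    moreover have "K \<subseteq> range y"
      using p by (auto simp only: K_def)
    ultimately show "\<exists>K. finite K \<and> K \<subseteq> range y \<and> range y \<subseteq> (\<Union>x\<in>K. N.mball x \<epsilon>)"
      by (intro exI[of _ K] conjI)
  qed
  then obtain r where r: "strict_mono r" "N.MCauchy (y \<circ> r)"
    unfolding N.mtotally_bounded_sequentially by blast
  moreover have "N.mcomplete"
    using N.complete by (simp add: complete_structure_def)
  ultimately obtain d where "limitin N.mtopology (y \<circ> r) d sequentially"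
    unfolding N.mcomplete_def by blast
  then have d: "d \<in> univ N" "\<And>e. e > 0 \<Longrightarrow> \<exists>m0. \<forall>m\<ge>m0. mdist_of L N (y (r m)) d < e"
    unfolding N.limit_metric_sequentially comp_apply by (blast, meson)
  show ?thesis
  proof (intro bexI[OF _ d(1)] ballI)
    fix \<phi> assume "\<phi> \<in> \<Phi>"
    then obtain i where i: "\<psi> i = \<phi>" using \<psi>_surj by (auto simp: \<Psi>_def)
    have "\<bar>val N \<phi> (w(n := d)) - val M \<phi> (v(n := c))\<bar> \<le> 0 + e" if "e > 0" for e
    proof -
      have "wf_fm L \<phi>" "e / 2 > 0" using \<psi>[of i] i \<open>e > 0\<close> by auto
      from N.val_uniformly_continuous[OF this]
      obtain \<delta> where \<delta>: "\<delta> > 0" "\<forall>v\<in>assigns N. \<forall>w\<in>assigns N.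
          (\<forall>i\<in>fv \<phi>. mdist_of L N (v i) (w i) < \<delta>) \<longrightarrow> \<bar>val N \<phi> v - val N \<phi> w\<bar> \<le> e / 2"
        by (elim exE conjE)
      obtain m0 where m0: "\<And>m. m \<ge> m0 \<Longrightarrow> mdist_of L N (y (r m)) d < \<delta>"
        using d(2)[OF \<delta>(1)] by blast
      obtain l where l: "inverse (real (Suc l)) < e / 2"
        using reals_Archimedean[of "e / 2"] \<open>e > 0\<close> by auto
      \<comment> \<open>Past \<open>m0\<close> the subsequence is within \<delta> of
        \<open>d\<close>, past \<open>i\<close> the formula is among those approximated, and past
        \<open>l\<close> the error is below e/2.\<close>
      define m where "m = max m0 (max i l)"
      have "m \<le> r m" using r(1) by (rule strict_mono_imp_increasing)
      then have "inverse (real (Suc (r m))) \<le> inverse (real (Suc l))"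
        by (simp add: m_def)
      moreover have "\<bar>val N \<phi> (w(n := y (r m))) - val M \<phi> (v(n := c))\<bar> < inverse (real (Suc (r m)))"
        using y(2)[of i "r m"] \<open>m \<le> r m\<close> by (simp add: i m_def)
      moreover have "\<bar>val N \<phi> (w(n := y (r m))) - val N \<phi> (w(n := d))\<bar> \<le> e / 2"
        by (rule \<delta>(2)[rule_format]) (use w y(1) d(1) m0[of m] \<delta>(1) in \<open>auto simp: m_def\<close>)
      ultimately show ?thesis using l by linarith
    qed
    then have "\<bar>val N \<phi> (w(n := d)) - val M \<phi> (v(n := c))\<bar> \<le> 0"
      by (rule field_le_epsilon)
    then show "val N \<phi> (w(n := d)) = val M \<phi> (v(n := c))" by simp
  qed
qed

text \<open>The language may be uncountable, but \<open>N\<close> is Lindelof, so countably many formulas suffice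
  to rule out every \<open>d\<close> of the wrong type.\<close>

lemma forth:
  assumes M: "full_structure L M" and N: "full_structure L N"
    and eqv: "eqv L M N n v w" and c: "c \<in> univ M"
  shows "\<exists>d\<in>univ N. eqv L M N (Suc n) (v(n := c)) (w(n := d))"
proof (rule ccontr)
  interpret M: full_structure L M by (fact M)
  interpret N: full_structure L N by (fact N)
  have v: "v \<in> assigns M" and w: "w \<in> assigns N"
    using eqv by (auto simp: eqv_def)
  define \<Phi> where "\<Phi> = {\<phi>. wf_fm L \<phi> \<and> fv \<phi> \<subseteq> {..n}}"
  define P where "P \<phi> z \<longleftrightarrow> val N \<phi> (w(n := z)) \<noteq> val M \<phi> (v(n := c))" for \<phi> z
  assume "\<not> (\<exists>d\<in>univ N. eqv L M N (Suc n) (v(n := c)) (w(n := d)))"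
  then have none: "\<not> eqv L M N (Suc n) (v(n := c)) (w(n := d))" if "d \<in> univ N" for d
    using that by blast
  have "\<exists>\<phi>\<in>\<Phi>. \<exists>r>0. \<forall>z\<in>univ N. mdist_of L N y z < r \<longrightarrow> P \<phi> z" if y: "y \<in> univ N" for y
  proof -
    have "\<exists>\<phi>\<in>\<Phi>. P \<phi> y"
      using none[OF y] v w c y by (auto simp: eqv_def \<Phi>_def P_def lessThan_Suc_atMost)
    then obtain \<phi> where \<phi>: "\<phi> \<in> \<Phi>" "P \<phi> y" by blast
    \<comment> \<open>Having the wrong value is an open condition on \<open>z\<close>: moving by
      less than \<open>r\<close> closes at most half of the gap.\<close>
    define \<epsilon> where "\<epsilon> = \<bar>val N \<phi> (w(n := y)) - val M \<phi> (v(n := c))\<bar>"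
    have "wf_fm L \<phi>" "\<epsilon> / 2 > 0" using \<phi> by (auto simp: \<Phi>_def P_def \<epsilon>_def)
    from N.val_uniformly_continuous[OF this]
    obtain r where r: "r > 0" "\<forall>v\<in>assigns N. \<forall>w\<in>assigns N.
        (\<forall>i\<in>fv \<phi>. mdist_of L N (v i) (w i) < r) \<longrightarrow> \<bar>val N \<phi> v - val N \<phi> w\<bar> \<le> \<epsilon> / 2"
      by (elim exE conjE)
    have "P \<phi> z" if z: "z \<in> univ N" "mdist_of L N y z < r" for z
    proof -
      have "\<bar>val N \<phi> (w(n := y)) - val N \<phi> (w(n := z))\<bar> \<le> \<epsilon> / 2"
        by (rule r(2)[rule_format]) (use w y z r(1) in auto)
      then show ?thesis using \<open>\<epsilon> / 2 > 0\<close> by (auto simp: P_def \<epsilon>_def)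
    qed
    then show ?thesis using \<phi>(1) r(1) by blast
  qed
  then obtain \<Psi> where \<Psi>: "countable \<Psi>" "\<Psi> \<subseteq> \<Phi>" "\<forall>y\<in>univ N. \<exists>\<phi>\<in>\<Psi>. P \<phi> y"
    by (rule N.countable_subfamily)
  have "\<And>\<phi>. \<phi> \<in> \<Psi> \<Longrightarrow> wf_fm L \<phi> \<and> fv \<phi> \<subseteq> {..n}"
    using \<Psi>(2) by (auto simp: \<Phi>_def)
  then obtain d where "d \<in> univ N" "\<forall>\<phi>\<in>\<Psi>. val N \<phi> (w(n := d)) = val M \<phi> (v(n := c))"
    using countable_realization[OF M N eqv c \<Psi>(1)] by blast
  then show False using \<Psi>(3) by (force simp: P_def)
qed

section \<open>Matching two dense sequences\<close>

lemma forth_converse: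
  assumes M: "full_structure L M" and N: "full_structure L N"
    and eqv: "eqv L M N n v w" and d: "d \<in> univ N"
  shows "\<exists>c\<in>univ M. eqv L M N (Suc n) (v(n := c)) (w(n := d))"
  using forth[OF N M eqv_sym[OF eqv] d] eqv_sym by blast

text \<open>Stage \<open>k\<close> fixes entry n + k on both sides: even stages prescribe it in
  \<open>M\<close> and odd ones in \<open>N\<close>, while \<open>forth\<close> or
  \<open>forth_converse\<close> finds the partner. Earlier entries never change, so the stages have
  a limit.\<close>

lemma back_and_forth:
  assumes M: "full_structure L M" and N: "full_structure L N" and eqv: "eqv L M N n v w"
    and e: "\<And>k. e k \<in> univ M" and e': "\<And>k. e' k \<in> univ N"
  shows "\<exists>a b. (\<forall>m. eqv L M N m a b) \<and> (\<forall>i<n. a i = v i \<and> b i = w i) \<and>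
    (\<forall>k. a (n + 2 * k) = e k) \<and> (\<forall>k. b (n + (2 * k + 1)) = e' k)"
proof -
  define P where "P k = (\<lambda>(v', w'). eqv L M N (n + k) v' w' \<and> (\<forall>i<n. v' i = v i \<and> w' i = w i))" for k
  define Q where "Q k = (\<lambda>(v', w') (v'', w''). (\<forall>i<n + k. v'' i = v' i \<and> w'' i = w' i) \<and>
      (even k \<longrightarrow> v'' (n + k) = e (k div 2)) \<and> (odd k \<longrightarrow> w'' (n + k) = e' (k div 2)))" for k
  have "\<exists>s. P 0 s"
    using eqv by (auto simp: P_def intro!: exI[of _ v] exI[of _ w])
  moreover have "\<exists>s'. P (Suc k) s' \<and> Q k s s'" if "P k s" for k s
  proof -
    obtain v' w' where s: "s = (v', w')" by fastforce
    have P: "eqv L M N (n + k) v' w'" "\<forall>i<n. v' i = v i \<and> w' i = w i"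
      using that by (auto simp: P_def s)
    show ?thesis
    proof (cases "even k")
      case True
      obtain d where "eqv L M N (Suc (n + k)) (v'(n + k := e (k div 2))) (w'(n + k := d))"
        using forth[OF M N P(1) e] by blast
      then show ?thesis
        using P(2) True
        by (intro exI[of _ "(v'(n + k := e (k div 2)), w'(n + k := d))"]) (auto simp: P_def Q_def s)
    next
      case False
      obtain c where "eqv L M N (Suc (n + k)) (v'(n + k := c)) (w'(n + k := e' (k div 2)))"
        using forth_converse[OF M N P(1) e'] by blast
      then show ?thesis
        using P(2) False
        by (intro exI[of _ "(v'(n + k := c), w'(n + k := e' (k div 2)))"]) (auto simp: P_def Q_def s)
    qed
  qed
  ultimately obtain s where s: "\<And>k. P k (s k)" "\<And>k. Q k (s k) (s (Suc k))"
    using dependent_nat_choice[of P Q] by blast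
  \<comment> \<open>Entry \<open>i\<close> is final from stage \<open>Suc i\<close> on, even when
    \<open>n\<close> is 0.\<close>
  define a where "a i = fst (s (Suc i)) i" for i
  define b where "b i = snd (s (Suc i)) i" for i
  have Ps: "eqv L M N (n + k) (fst (s k)) (snd (s k))"
    "\<And>i. i < n \<Longrightarrow> fst (s k) i = v i \<and> snd (s k) i = w i" for k
    using s(1)[of k] by (auto simp: P_def case_prod_beta)
  have Qs: "\<And>i. i < n + k \<Longrightarrow> fst (s (Suc k)) i = fst (s k) i \<and> snd (s (Suc k)) i = snd (s k) i"
    "even k \<Longrightarrow> fst (s (Suc k)) (n + k) = e (k div 2)"
    "odd k \<Longrightarrow> snd (s (Suc k)) (n + k) = e' (k div 2)" for k
    using s(2)[of k] by (auto simp: Q_def case_prod_beta)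
  have stable: "fst (s (k + l)) i = fst (s k) i \<and> snd (s (k + l)) i = snd (s k) i" if "i < n + k" for i k l
    using that Qs(1)[of i "k + _"] by (induction l) auto
  have ab: "a i = fst (s k) i \<and> b i = snd (s k) i" if "i < n + k" for i k
    using stable[of i k "Suc i"] stable[of i "Suc i" k] that
    by (simp add: a_def b_def add.commute)
  show ?thesis
  proof (intro exI[of _ a] exI[of _ b] conjI allI impI)
    have mem: "fst (s k) \<in> assigns M" "snd (s k) \<in> assigns N" for k
      using Ps(1)[of k] by (auto simp: eqv_def)
    have a: "a \<in> assigns M" and b: "b \<in> assigns N"
      using mem by (auto simp: assigns_def a_def b_def)
    show "eqv L M N m a b" for m
    proof -
      have "eqv L M N (n + m) a b"
        by (rule eqv_cong[OF Ps(1)[of m] a b]) (use ab in auto)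
      moreover have "{..<m} \<subseteq> {..<n + m}" by auto
      ultimately show ?thesis unfolding eqv_def by (meson order_trans)
    qed
    show "a i = v i" "b i = w i" if "i < n" for i
      using that ab[of i 0] Ps(2)[of i 0] by simp_all
    show "a (n + 2 * k) = e k" for k
      using ab[of "n + 2 * k" "Suc (2 * k)"] Qs(2)[of "2 * k"] by simp
    show "b (n + (2 * k + 1)) = e' k" for k
      using ab[of "n + (2 * k + 1)" "Suc (2 * k + 1)"] Qs(3)[of "2 * k + 1"] by simp
  qed
qed

section \<open>The limit isomorphism\<close>

context full_structure
begin

text \<open>A subsequence of \<open>a\<close> tends to \<open>x\<close>, so the corresponding part
  of \<open>b\<close> is Cauchy and converges by completeness; distances pass to the limit. The
  other space is arbitrary, so that the lemma serves both directions.\<close>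

lemma limit_point:
  assumes x: "Metric_space X dX" "x \<in> X" and a: "\<And>i. a i \<in> X" and b: "\<And>i. b i \<in> univ M"
    and dense: "\<And>\<delta>. \<delta> > 0 \<Longrightarrow> \<exists>i. dX (a i) x < \<delta>"
    and isometric: "\<And>i j. mdist_of L M (b i) (b j) = dX (a i) (a j)"
  obtains y where "y \<in> univ M" "\<forall>i. mdist_of L M (b i) y = dX (a i) x"
proof -
  interpret X: Metric_space X dX by (fact x)
  have "\<exists>i. dX (a i) x < inverse (real (Suc k))" for k
    by (rule dense) simp
  then obtain r where r: "\<And>k. dX (a (r k)) x < inverse (real (Suc k))" by metis
  have small: "\<exists>k0. \<forall>k\<ge>k0. dX (a (r k)) x < e" if "e > 0" for e
  proof -
    obtain k0 where "inverse (real (Suc k0)) < e"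
      using reals_Archimedean[OF \<open>e > 0\<close>] by auto
    moreover have "inverse (real (Suc k)) \<le> inverse (real (Suc k0))" if "k \<ge> k0" for k
      using that by simp
    ultimately show ?thesis using r by (meson less_le_trans less_trans)
  qed
  have "MCauchy (b \<circ> r)"
    unfolding MCauchy_def
  proof (intro conjI allI impI)
    show "range (b \<circ> r) \<subseteq> univ M" using b by auto
    fix e :: real assume "e > 0"
    then obtain k0 where k0: "\<And>k. k \<ge> k0 \<Longrightarrow> dX (a (r k)) x < e / 2"
      using small[of "e / 2"] by auto
    have "mdist_of L M ((b \<circ> r) k) ((b \<circ> r) l) < e" if "k \<ge> k0" "l \<ge> k0" for k l
    proof -
      have "dX (a (r k)) (a (r l)) \<le> dX (a (r k)) x + dX x (a (r l))"
        by (intro X.triangle a x)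
      then show ?thesis
        using k0[OF that(1)] k0[OF that(2)] X.commute[of x "a (r l)"] by (simp add: isometric)
    qed
    then show "\<exists>k0. \<forall>k l. k0 \<le> k \<longrightarrow> k0 \<le> l \<longrightarrow> mdist_of L M ((b \<circ> r) k) ((b \<circ> r) l) < e"
      by blast
  qed
  then obtain y where "limitin mtopology (b \<circ> r) y sequentially"
    using complete unfolding complete_structure_def mcomplete_def by blast
  then have y: "y \<in> univ M" "\<And>e. e > 0 \<Longrightarrow> \<exists>k0. \<forall>k\<ge>k0. mdist_of L M (b (r k)) y < e"
    unfolding limit_metric_sequentially comp_apply by (blast, meson)
  have "mdist_of L M (b i) y = dX (a i) x" for i
  proof -
    have "\<bar>mdist_of L M (b i) y - dX (a i) x\<bar> \<le> 0 + e" if "e > 0" for e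
    proof -
      obtain k1 where k1: "\<And>k. k \<ge> k1 \<Longrightarrow> dX (a (r k)) x < e / 2"
        using small[of "e / 2"] \<open>e > 0\<close> by auto
      obtain k2 where k2: "\<And>k. k \<ge> k2 \<Longrightarrow> mdist_of L M (b (r k)) y < e / 2"
        using y(2)[of "e / 2"] \<open>e > 0\<close> by auto
      define k where "k = max k1 k2"
      have "dX (a (r k)) x < e / 2" "mdist_of L M (b (r k)) y < e / 2"
        using k1[of k] k2[of k] by (auto simp: k_def)
      moreover have "mdist_of L M (b i) y \<le> mdist_of L M (b i) (b (r k)) + mdist_of L M (b (r k)) y"
        "mdist_of L M (b i) (b (r k)) \<le> mdist_of L M (b i) y + mdist_of L M y (b (r k))"
        using b y by (auto intro!: triangle)
      moreover have "dX (a i) x \<le> dX (a i) (a (r k)) + dX (a (r k)) x"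
        "dX (a i) (a (r k)) \<le> dX (a i) x + dX x (a (r k))"
        using a x by (auto intro!: X.triangle)
      ultimately show ?thesis
        using commute[of y "b (r k)"] X.commute[of x "a (r k)"] isometric[of i "r k"] by linarith
    qed
    then have "\<bar>mdist_of L M (b i) y - dX (a i) x\<bar> \<le> 0" by (rule field_le_epsilon)
    then show ?thesis by simp
  qed
  then show thesis using that y(1) by blast
qed

text \<open>Any \<open>b i\<close> close to \<open>y\<close> is equally close to
  \<open>y'\<close>.\<close>

lemma eq_if_equidistant:
  assumes "y \<in> univ M" "y' \<in> univ M" "\<And>i. b i \<in> univ M"
    and dense: "\<And>\<delta>. \<delta> > 0 \<Longrightarrow> \<exists>i. mdist_of L M (b i) y < \<delta>"
    and eq: "\<And>i. mdist_of L M (b i) y = mdist_of L M (b i) y'"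
  shows "y = y'"
proof -
  have "mdist_of L M y y' \<le> 0 + e" if e: "e > 0" for e
  proof -
    obtain i where i: "mdist_of L M (b i) y < e / 2" using dense[of "e / 2"] e by auto
    have "mdist_of L M y y' \<le> mdist_of L M y (b i) + mdist_of L M (b i) y'"
      using assms by (intro triangle)
    then show ?thesis using i eq[of i] commute[of y "b i"] by linarith
  qed
  then have "mdist_of L M y y' \<le> 0" by (rule field_le_epsilon)
  then show ?thesis using assms(1,2) nonneg[of y y'] by (simp add: zero order_antisym)
qed

end

lemma is_isoI:
  assumes "bij_betw f (univ M) (univ N)" "univ M \<noteq> {}"
    and pres: "\<And>\<phi> v. wf_fm L \<phi> \<Longrightarrow> v \<in> assigns M \<Longrightarrow> val N \<phi> (f \<circ> v) = val M \<phi> v"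
  shows "is_iso L f M N"
  unfolding is_iso_def
proof (intro conjI allI impI ballI assms)
  fix R as assume as: "as \<in> lists (univ M)" "length as = arity L R"
  obtain a where a: "a \<in> univ M" using assms(2) by blast
  define v where "v i = (if i < length as then as ! i else a)" for i
  have "v \<in> assigns M" using as a by (auto simp: assigns_def v_def)
  moreover have "wf_fm L (Rel R [0..<length as])" using as by simp
  moreover have "map v [0..<length as] = as" by (rule nth_equalityI) (auto simp: v_def)
  ultimately show "rel N R (map f as) = rel M R as"
    using pres by (metis map_map val.simps(1))
qed (use pres in \<open>simp del: val.simps\<close>)

lemma isomorphism_extending:
  fixes M :: "('r, 'a) struct" and N :: "('r, 'b) struct"
  assumes M: "full_structure L M" and N: "full_structure L N" and eqv: "eqv L M N n v w"
  obtains f where "is_iso L f M N" "\<And>i. i < n \<Longrightarrow> f (v i) = w i"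
proof -
  interpret M: full_structure L M by (fact M)
  interpret N: full_structure L N by (fact N)
  obtain e :: "nat \<Rightarrow> 'a" where e: "\<forall>i. e i \<in> univ M"
    "\<forall>x\<in>univ M. \<forall>\<delta>>0. \<forall>m. \<exists>i\<ge>m. mdist_of L M (e i) x < \<delta>"
    using M.dense_enumeration by (elim exE conjE)
  obtain e' :: "nat \<Rightarrow> 'b" where e': "\<forall>i. e' i \<in> univ N"
    "\<forall>x\<in>univ N. \<forall>\<delta>>0. \<forall>m. \<exists>i\<ge>m. mdist_of L N (e' i) x < \<delta>"
    using N.dense_enumeration by (elim exE conjE)
  obtain a b where ab: "\<forall>m. eqv L M N m a b" "\<forall>i<n. a i = v i \<and> b i = w i"
    "\<forall>k. a (n + 2 * k) = e k" "\<forall>k. b (n + (2 * k + 1)) = e' k"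
    using back_and_forth[OF M N eqv, of e e'] e(1) e'(1) by auto
  have a: "a \<in> assigns M" and b: "b \<in> assigns N"
    using ab(1) by (auto simp: eqv_def)
  have a_dense: "\<exists>i\<ge>m. mdist_of L M (a i) x < \<delta>" if x: "x \<in> univ M" "\<delta> > 0" for x \<delta> m
  proof -
    obtain k where "k \<ge> m" "mdist_of L M (e k) x < \<delta>" using e(2) x by blast
    then show ?thesis using ab(3)[rule_format, of k] by (intro exI[of _ "n + 2 * k"]) auto
  qed
  have b_dense: "\<exists>i\<ge>m. mdist_of L N (b i) x < \<delta>" if x: "x \<in> univ N" "\<delta> > 0" for x \<delta> m
  proof -
    obtain k where "k \<ge> m" "mdist_of L N (e' k) x < \<delta>" using e'(2) x by blast
    then show ?thesis using ab(4)[rule_format, of k] by (intro exI[of _ "n + (2 * k + 1)"]) auto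
  qed
  have same: "val M \<phi> a = val N \<phi> b" if "wf_fm L \<phi>" for \<phi>
  proof -
    obtain m where "fv \<phi> \<subseteq> {..<m}"
      using finite_fv[of \<phi>] finite_nat_iff_bounded by auto
    then show ?thesis using ab(1)[rule_format, of m] that by (simp add: eqv_def)
  qed
  have isometric: "mdist_of L N (b i) (b j) = mdist_of L M (a i) (a j)" for i j
  proof (cases "i = j")
    case True
    then show ?thesis using a b by simp
  next
    case False
    then show ?thesis
      using same M.mdist_of_formula[OF a False] N.mdist_of_formula[OF b False] M.wf_metric
      by (metis wf_ren)
  qed
  \<comment> \<open>The graph of the continuous extension of \<open>a i \<mapsto> b i\<close>,
    described by distances. The description is symmetric in the two models, so surjectivity and
    injectivity follow like totality and uniqueness.\<close>
  define R where "R x y \<longleftrightarrow> y \<in> univ N \<and> (\<forall>i. mdist_of L N (b i) y = mdist_of L M (a i) x)" for x y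
  have R_total: "\<exists>y. R x y" if x: "x \<in> univ M" for x
  proof -
    obtain y where "y \<in> univ N" "\<forall>i. mdist_of L N (b i) y = mdist_of L M (a i) x"
      by (rule N.limit_point[OF M.Metric_space_axioms x, of a b])
        (use a b a_dense[OF x, of _ 0] isometric in auto)
    then show ?thesis by (auto simp: R_def)
  qed
  have R_surj: "\<exists>x\<in>univ M. R x y" if y: "y \<in> univ N" for y
  proof -
    obtain x where "x \<in> univ M" "\<forall>i. mdist_of L M (a i) x = mdist_of L N (b i) y"
      by (rule M.limit_point[OF N.Metric_space_axioms y, of b a])
        (use a b b_dense[OF y, of _ 0] isometric in auto)
    then show ?thesis using y by (intro bexI[of _ x]) (simp_all add: R_def)
  qed
  have R_fun: "y = y'" if "R x y" "R x y'" for x y y'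
    by (rule N.eq_if_equidistant[of y y' b]) (use that b b_dense[of y _ 0] in \<open>auto simp: R_def\<close>)
  have R_inj: "x = x'" if "R x y" "R x' y" "x \<in> univ M" "x' \<in> univ M" for x x' y
    by (rule M.eq_if_equidistant[of x x' a]) (use that a a_dense[of x _ 0] in \<open>auto simp: R_def\<close>)
  define f where "f x = (SOME y. R x y)" for x
  have f: "R x (f x)" if "x \<in> univ M" for x
    unfolding f_def using R_total[OF that] by (rule someI_ex)
  have fa: "f (a i) = b i" for i
    using f[of "a i"] R_fun[of "a i" "f (a i)" "b i"] a b isometric by (simp add: R_def)
  have "bij_betw f (univ M) (univ N)"
    unfolding bij_betw_def
  proof
    show "inj_on f (univ M)"
      by (rule inj_onI) (metis R_inj f)
    show "f ` univ M = univ N"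
    proof
      show "f ` univ M \<subseteq> univ N" using f by (auto simp: R_def)
      show "univ N \<subseteq> f ` univ M" using R_surj R_fun f by (metis image_eqI subsetI)
    qed
  qed
  moreover have "val N \<phi> (f \<circ> s) = val M \<phi> s" if \<phi>: "wf_fm L \<phi>" and s: "s \<in> assigns M" for \<phi> s
  proof -
    have fs: "f \<circ> s \<in> assigns N"
      using f s by (auto simp: assigns_def R_def)
    have "\<bar>val N \<phi> (f \<circ> s) - val M \<phi> s\<bar> \<le> 0 + \<epsilon>" if "\<epsilon> > 0" for \<epsilon>
    proof -
      have "\<epsilon> / 2 > 0" using \<open>\<epsilon> > 0\<close> by simp
      from M.val_uniformly_continuous[OF \<phi> this]
      obtain \<delta> where \<delta>: "\<delta> > 0" "\<forall>v\<in>assigns M. \<forall>w\<in>assigns M.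
          (\<forall>i\<in>fv \<phi>. mdist_of L M (v i) (w i) < \<delta>) \<longrightarrow> \<bar>val M \<phi> v - val M \<phi> w\<bar> \<le> \<epsilon> / 2"
        by (elim exE conjE)
      from N.val_uniformly_continuous[OF \<phi> \<open>\<epsilon> / 2 > 0\<close>]
      obtain \<delta>' where \<delta>': "\<delta>' > 0" "\<forall>v\<in>assigns N. \<forall>w\<in>assigns N.
          (\<forall>i\<in>fv \<phi>. mdist_of L N (v i) (w i) < \<delta>') \<longrightarrow> \<bar>val N \<phi> v - val N \<phi> w\<bar> \<le> \<epsilon> / 2"
        by (elim exE conjE)
      let ?P = "\<lambda>k i. mdist_of L M (a i) (s k) < min \<delta> \<delta>'"
      \<comment> \<open>The entries of \<open>s\<close> are approximated by members of the sequence
        \<open>a\<close> at strictly increasing, hence distinct, indices. Then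
        \<open>ren \<tau> \<phi>\<close> is a legitimate renaming, and its values at
        \<open>a\<close> and \<open>b\<close> agree, even if \<open>s\<close> repeats
        values.\<close>
      have "\<exists>\<tau>. \<forall>k. ?P k (\<tau> k) \<and> \<tau> k < \<tau> (Suc k)"
      proof (rule dependent_nat_choice)
        show "\<exists>i. ?P 0 i"
          using a_dense[of "s 0" "min \<delta> \<delta>'" 0] s \<delta>(1) \<delta>'(1) by auto
        show "\<exists>j. ?P (Suc k) j \<and> i < j" if "?P k i" for i k
          using a_dense[of "s (Suc k)" "min \<delta> \<delta>'" "Suc i"] s \<delta>(1) \<delta>'(1) by (auto simp: Suc_le_eq)
      qed
      then obtain \<tau> where \<tau>: "\<And>k. ?P k (\<tau> k)" "\<And>k. \<tau> k < \<tau> (Suc k)" by blast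
      have "inj \<tau>"
        using \<tau>(2) by (simp add: strict_mono_Suc_iff strict_mono_imp_inj_on)
      then have eq: "val M \<phi> (a \<circ> \<tau>) = val N \<phi> (b \<circ> \<tau>)"
        using same[of "ren \<tau> \<phi>"] \<phi> by (simp add: val_ren)
      have "mdist_of L N (b (\<tau> k)) (f (s k)) = mdist_of L M (a (\<tau> k)) (s k)" for k
        using f[of "s k"] s by (simp add: R_def)
      then have "\<bar>val N \<phi> (b \<circ> \<tau>) - val N \<phi> (f \<circ> s)\<bar> \<le> \<epsilon> / 2"
        by (intro \<delta>'(2)[rule_format]) (use \<tau>(1) b fs in auto)
      moreover have "\<bar>val M \<phi> (a \<circ> \<tau>) - val M \<phi> s\<bar> \<le> \<epsilon> / 2"
        by (intro \<delta>(2)[rule_format]) (use \<tau>(1) a s in auto)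
      ultimately show ?thesis using eq by linarith
    qed
    then have "\<bar>val N \<phi> (f \<circ> s) - val M \<phi> s\<bar> \<le> 0" by (rule field_le_epsilon)
    then show ?thesis by simp
  qed
  ultimately have "is_iso L f M N" using M.univ_nonempty by (intro is_isoI)
  moreover have "f (v i) = w i" if "i < n" for i
    using fa[of i] ab(2) that by simp
  ultimately show thesis using that by blast
qed

text \<open>Both claims extend a type-preserving correspondence of finite tuples. For
  \<open>M\<close> and \<open>N\<close> the tuples are empty, and the types agree because
  \<open>T\<close> fixes the value of every sentence; for automorphisms the tuples are
  \<open>as\<close> and \<open>bs\<close>.\<close>

theorem mainTheorem7:
  fixes L :: "'r language" and T :: "('r fm \<times> real) set" and M :: "('r, 'a) struct"
  assumes "is_language L" and "complete_theory L T"
    and "models L M T" and "complete_structure L M" and "full_support L M"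
  shows "(\<forall>N :: ('r, 'b) struct.
            models L N T \<longrightarrow> complete_structure L N \<longrightarrow> full_support L N \<longrightarrow>
              (\<exists>f. is_iso L f M N)) \<and>
         (\<forall>as bs. as \<in> lists (univ M) \<longrightarrow> bs \<in> lists (univ M) \<longrightarrow> length as = length bs \<longrightarrow>
            tp L M as = tp L M bs \<longrightarrow>
              (\<exists>f. is_iso L f M M \<and> map f as = bs))"
proof (intro conjI allI impI)
  have M: "full_structure L M"
    using assms by unfold_locales (auto simp: models_def)
  then interpret M: full_structure L M .
  obtain a where a: "a \<in> univ M" using M.univ_nonempty by blast
  {
    fix N :: "('r, 'b) struct"
    assume N': "models L N T" "complete_structure L N" "full_support L N"
    have N: "full_structure L N"
      using assms N' by unfold_locales (auto simp: models_def)
    then interpret N: full_structure L N .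
    obtain b where b: "b \<in> univ N" using N.univ_nonempty by (meson ex_in_conv)
    have "val M \<sigma> (\<lambda>_. a) = val N \<sigma> (\<lambda>_. b)" if "wf_fm L \<sigma>" "fv \<sigma> = {}" for \<sigma>
    proof -
      have "\<exists>!r. (\<sigma>, r) \<in> T"
        using assms(2) that by (simp add: complete_theory_def)
      then obtain r where "(\<sigma>, r) \<in> T" by (elim ex1E)
      then have "\<forall>v\<in>assigns M. val M \<sigma> v = r" "\<forall>v\<in>assigns N. val N \<sigma> v = r"
        using assms(3) N'(1) by (auto simp: models_def)
      then have "val M \<sigma> (\<lambda>_. a) = r" "val N \<sigma> (\<lambda>_. b) = r"
        using a b by simp_all
      then show ?thesis by simp
    qed
    then have "eqv L M N 0 (\<lambda>_. a) (\<lambda>_. b)"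
      using a b by (simp add: eqv_def)
    then show "\<exists>f. is_iso L f M N"
      using isomorphism_extending[OF M N] by blast
  next
    fix as bs assume as: "as \<in> lists (univ M)" "bs \<in> lists (univ M)" "length as = length bs"
      and tp: "tp L M as = tp L M bs"
    define v where "v i = (if i < length as then as ! i else a)" for i
    define w where "w i = (if i < length bs then bs ! i else a)" for i
    have v: "v \<in> assigns M" and w: "w \<in> assigns M"
      using as a by (auto simp: assigns_def v_def w_def)
    have "val M \<phi> v = val M \<phi> w" if \<phi>: "wf_fm L \<phi>" "fv \<phi> \<subseteq> {..<length as}" for \<phi>
    proof -
      \<comment> \<open>Membership in \<open>tp\<close> speaks of every assignment starting with
        \<open>as\<close>, and the value of \<phi> depends on those entries only.\<close>
      have "val M \<phi> u = val M \<phi> v" if "\<forall>i<length as. u i = as ! i" for u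
        by (rule val_cong) (use \<phi> that in \<open>auto simp: v_def\<close>)
      then have "(\<phi>, val M \<phi> v) \<in> tp L M bs"
        using \<phi> unfolding tp[symmetric] by (auto simp: tp_def)
      then show ?thesis
        using w by (auto simp: tp_def w_def)
    qed
    then have "eqv L M M (length as) v w"
      using v w by (simp add: eqv_def)
    then obtain f where "is_iso L f M M" "\<And>i. i < length as \<Longrightarrow> f (v i) = w i"
      using isomorphism_extending[OF M M] by blast
    moreover from this have "map f as = bs"
      using as(3) by (intro nth_equalityI) (auto simp: v_def w_def)
    ultimately show "\<exists>f. is_iso L f M M \<and> map f as = bs" by blast
  }
qed

end
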